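(* Let $r\ge 1$, $m_0\ge m_1\ge\cdots\ge m_r\ge 1$, $A_0$ a real symmetric positive definite $m_0\times m_0$ matrix, and $B_k$ a real $m_{k-1}\times m_k$ matrix of rank $m_k$ for $k=1,\dots,r$. Let $A$, $B$, $E(t)=\exp(-tB^* )$, $\mathcal{C}(t)=\int_0^tE(s)AE^*(s)\,ds$ and the semigroup $(P_t)_{t\ge 0}$ on $\mathbb{R}^N=\mathbb{R}^{m_0}\times\cdots\times\mathbb{R}^{m_r}$ be the associated objects defined in the context. (i) (Poincaré inequality) Let $f\in C^1(\mathbb{R}^{N})$ be a globally Lipschitz bounded function. Then for every $t\ge 0$, at every $x\in\mathbb{R}^N$, $$P_t(f^2)-(P_tf)^2\le P_t\left(\left\langle\int_0^tE(-(t-s))AE^*(-(t-s))\,ds\,\nabla f,\nabla f\right\rangle\right).$$ (ii) (Reverse Poincaré inequality) For every $t>0$ and every bounded Borel measurable function $f$ on $\mathbb{R}^N$, at every $x\in\mathbb{R}^N$, $$P_t(f^2)-(P_tf)^2\ge\left\langle\mathcal{C}(t)\nabla P_tf,\nabla P_tf\right\rangle.$$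
   Context: $N=\sum_{k=0}^rm_k$. In block form (block sizes $m_0,\dots,m_r$), $A=\begin{pmatrix}A_0&0\\0&0\end{pmatrix}$ is the $N\times N$ matrix with upper left block $A_0$ and zeros elsewhere, and $B$ is the $N\times N$ matrix whose $(k,k+1)$ block is $B_k$ for $1\le k\le r$ and all of whose other blocks are zero. $M^*$ denotes the transpose of a matrix $M$; $E^*(t)$ is the transpose of $E(t)$. Under these assumptions $\mathcal{C}(t)$ is positive definite for every $t>0$. $\nabla$ is the full gradient in $\mathbb{R}^N$ and $\langle\cdot,\cdot\rangle$ the Euclidean inner product. $P_t=e^{t\mathcal{L}}$ is the semigroup generated by $\mathcal{L}=\frac12\mathrm{div}(AD)+\langle x,BD\rangle$, $D=(\partial_{x_1},\dots,\partial_{x_N})$; explicitly $P_0f=f$ and, for $t>0$, $$P_tf(x)=\int_{\mathbb{R}^N}p(x-E(t)y,t)f(y)\,dy,\qquad p(x,t)=\frac{(2\pi)^{-N/2}}{\sqrt{\det\mathcal{C}(t)}}\exp\left(-\tfrac12\langle\mathcal{C}^{-1}(t)x,x\rangle\right).$$ *)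

theory Defs
  imports
    "Jordan_Normal_Form.DL_Rank"
    "HOL-Analysis.Analysis"
begin

hide_type (open) Matrix.vec
hide_const (open) Matrix.mat Matrix.vec Matrix.row Matrix.rows
no_notation Matrix.vec_index (infixl \<open>$\<close> 100)
no_notation Matrix.scalar_prod (infix \<open>\<bullet>\<close> 70)

text \<open>
  The given blocks have sizes depending on their position and are matrices with explicit
  dimensions (\<open>real mat\<close> from \<open>Jordan_Normal_Form\<close>); the space
  $\mathbb{R}^N$ and the assembled $N \times N$ matrices are the types \<open>real ^ 'n\<close> and
  \<open>real ^ 'n ^ 'n\<close>.
\<close>

definition sym_pos_def_mat :: "nat \<Rightarrow> real mat \<Rightarrow> bool" where
  "sym_pos_def_mat n M \<longleftrightarrow>
     M \<in> carrier_mat n n \<and> transpose_mat M = M \<and>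
     (\<forall>v \<in> carrier_vec n. v \<noteq> 0\<^sub>v n \<longrightarrow> scalar_prod v (M *\<^sub>v v) > 0)"

text \<open>
  A block structure labels each coordinate \<open>i\<close> of $\mathbb{R}^N$ bijectively with a pair
  \<open>(k, p)\<close>: position \<open>p < m k\<close> in the block \<open>k \<in> {0, \<dots>, r}\<close>. It identifies \<open>real ^ 'n\<close> with
  $\mathbb{R}^{m_0} \times \cdots \times \mathbb{R}^{m_r}$, and it forces
  \<open>CARD('n) = (\<Sum>k\<le>r. m k)\<close>.
\<close>

definition block_structure :: "nat \<Rightarrow> (nat \<Rightarrow> nat) \<Rightarrow> ('n \<Rightarrow> nat \<times> nat) \<Rightarrow> bool" where
  "block_structure r m \<beta> \<longleftrightarrow> bij_betw \<beta> UNIV (SIGMA k:{..r}. {..<m k})"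

definition block_A :: "('n::finite \<Rightarrow> nat \<times> nat) \<Rightarrow> real mat \<Rightarrow> real ^ 'n ^ 'n" where
  "block_A \<beta> A0 = (\<chi> i j.
     if fst (\<beta> i) = 0 \<and> fst (\<beta> j) = 0 then A0 $$ (snd (\<beta> i), snd (\<beta> j)) else 0)"

text \<open>
  Block rows and columns are numbered from \<open>0\<close> here, like the sizes \<open>m 0, \<dots>, m r\<close>. The
  $m_{k-1} \times m_k$ matrix \<open>Bs k\<close>, \<open>1 \<le> k \<le> r\<close>, therefore sits in block row \<open>k - 1\<close> and
  block column \<open>k\<close>, i.e. in the $(k, k+1)$ block when counting from one.
\<close>

definition block_B :: "('n::finite \<Rightarrow> nat \<times> nat) \<Rightarrow> (nat \<Rightarrow> real mat) \<Rightarrow> real ^ 'n ^ 'n" where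
  "block_B \<beta> Bs = (\<chi> i j.
     if fst (\<beta> j) = Suc (fst (\<beta> i)) then Bs (fst (\<beta> j)) $$ (snd (\<beta> i), snd (\<beta> j)) else 0)"

text \<open>
  The powers are taken with respect to \<open>**\<close>; the multiplication \<open>*\<close> on \<open>real ^ 'n ^ 'n\<close>
  is the componentwise one.
\<close>

definition matrix_exp :: "real ^ 'n ^ 'n \<Rightarrow> real ^ 'n ^ 'n::finite" where
  "matrix_exp M = (\<Sum>k. (1 / fact k) *\<^sub>R (((**) M) ^^ k) (mat 1))"

definition drift_E :: "real ^ 'n ^ 'n \<Rightarrow> real \<Rightarrow> real ^ 'n ^ 'n::finite" where
  "drift_E B t = matrix_exp ((- t) *\<^sub>R transpose B)"

definition cov_C :: "real ^ 'n ^ 'n \<Rightarrow> real ^ 'n ^ 'n \<Rightarrow> real \<Rightarrow> real ^ 'n ^ 'n::finite" where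
  "cov_C A B t = integral {0..t} (\<lambda>s. drift_E B s ** A ** transpose (drift_E B s))"

definition heat_kernel ::
  "real ^ 'n ^ 'n \<Rightarrow> real ^ 'n ^ 'n \<Rightarrow> real ^ 'n \<Rightarrow> real \<Rightarrow> real" where
  "heat_kernel A B x t =
     (2 * pi) powr (- (real CARD('n) / 2)) / sqrt (det (cov_C A B t)) *
     exp (- (1 / 2) * ((matrix_inv (cov_C A B t) *v x) \<bullet> x))"

definition semigroup_P ::
  "real ^ 'n ^ 'n \<Rightarrow> real ^ 'n ^ 'n \<Rightarrow> real \<Rightarrow> (real ^ 'n \<Rightarrow> real) \<Rightarrow> real ^ 'n \<Rightarrow> real" where
  "semigroup_P A B t f x =
     (if t = 0 then f x
      else (LINT y|lborel. heat_kernel A B (x - drift_E B t *v y) t * f y))"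

text \<open>As usual with \<open>THE\<close>, this is only meaningful where \<open>f\<close> is differentiable.\<close>

definition grad :: "('a::real_inner \<Rightarrow> real) \<Rightarrow> 'a \<Rightarrow> 'a" where
  "grad f x = (THE g. GDERIV f x :> g)"

definition C1_fun :: "('a::real_inner \<Rightarrow> real) \<Rightarrow> bool" where
  "C1_fun f \<longleftrightarrow> (\<forall>x. f differentiable (at x)) \<and> continuous_on UNIV (grad f)"

end

theory Submission
  imports Defs "HOL-Probability.Distributions"
begin

text \<open>
For \<open>t > 0\<close> the semigroup is a Gaussian average. The matrix \<open>B\<close> is nilpotent, so \<open>drift_E B t\<close> is
an invertible matrix with determinant \<open>1\<close> and inverse \<open>M = drift_E B (- t)\<close>. The covariance \<open>C\<close> is positive
definite (\<open>cov_C_positive\<close>) because the rank conditions on the blocks make the pair \<open>(A, B)\<close>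
observable (\<open>block_B_observable\<close>), and so it factors as \<open>L L\<^sup>T\<close> with \<open>L\<close> invertible. Substituting
\<open>y = M x + M L w\<close> gives (\<open>semigroup_P_eq_gauss\<close>)

  \<open>P\<^sub>t f x = E f (M x + M L W)\<close> with \<open>W\<close> a standard Gaussian vector.

Both inequalities are now statements about the function \<open>F w = f (M x + M L w)\<close>.

The Poincare inequality is the sharp inequality \<open>Var F \<le> E (norm (grad F))\<^sup>2\<close> for the standard Gaussian
(\<open>gauss_poincare\<close>), since the gradient of \<open>F\<close> is \<open>(M L)\<^sup>T\<close> applied to the gradient of \<open>f\<close>, and the matrix
\<open>(M L) (M L)\<^sup>T = M C M\<^sup>T\<close> is the one in the statement (\<open>cov_C_congruence\<close>). It is proved by
interpolating between two independent copies of \<open>W\<close> along a rotation.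

The reverse inequality is Bessel's inequality (\<open>gauss_reverse_poincare\<close>). A shift of \<open>x\<close> is a shift of the
Gaussian variable, so the average is differentiable even if \<open>f\<close> is only bounded and measurable
(\<open>gauss_shift_has_derivative\<close>), and its gradient is \<open>(L\<inverse>)\<^sup>T G\<close> with \<open>G = E (F W)\<close>. The quadratic form of
\<open>C\<close> at this gradient is \<open>G \<bullet> G\<close>, which is the squared length of the projection of \<open>F\<close> onto the linear
functions, and is therefore at most the variance of \<open>F\<close>.
\<close>

section \<open>Lebesgue measure under linear maps\<close>

lemma nn_integral_lborel_translate:
  fixes F :: "'a::euclidean_space \<Rightarrow> ennreal"
  assumes [measurable]: "F \<in> borel_measurable borel"
  shows "(\<integral>\<^sup>+x. F (a + x) \<partial>lborel) = (\<integral>\<^sup>+x. F x \<partial>lborel)"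
proof -
  have "(\<integral>\<^sup>+x. F x \<partial>lborel) = (\<integral>\<^sup>+x. F x \<partial>distr lborel borel ((+) a))"
    by (simp add: lborel_distr_plus)
  also have "\<dots> = (\<integral>\<^sup>+x. F (a + x) \<partial>lborel)"
    by (subst nn_integral_distr) auto
  finally show ?thesis by simp
qed

text \<open>
The map \<open>x \<mapsto> x + J (l x)\<close> would be a translation if the vector \<open>l x\<close> did not depend on \<open>x\<close>.
It depends on \<open>x\<close>, but not on the component of \<open>x\<close> that is moved. So one first moves \<open>x\<close> by an
additional \<open>J s\<close>, which changes nothing, and averages over \<open>s\<close> in the unit cube. After
exchanging the integrals, \<open>s\<close> can be replaced by \<open>s - l x\<close>, and translation invariance in \<open>s\<close>
and then in \<open>x\<close> removes both shifts.

Adding one row to another is such a map, and plane rotations are products of such maps, so the lemma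
serves both the linear change of variables and the rotation invariance of the Gaussian measure.
\<close>
lemma nn_integral_lborel_shear:
  fixes F :: "'a::euclidean_space \<Rightarrow> ennreal"
    and l :: "'a \<Rightarrow> 'b::euclidean_space" and J :: "'b \<Rightarrow> 'a"
  assumes [measurable]: "F \<in> borel_measurable borel" "l \<in> borel_measurable borel"
      "J \<in> borel_measurable borel"
    and J_add: "\<And>s u. J (s + u) = J s + J u"
    and l_inv: "\<And>x s. l (J s + x) = l x"
  shows "(\<integral>\<^sup>+x. F (x + J (l x)) \<partial>lborel) = (\<integral>\<^sup>+x. F x \<partial>lborel)"
proof -
  \<comment> \<open>\<open>k\<close> is the weight of the average over the shift \<open>s\<close>.\<close>
  define k :: "'b \<Rightarrow> ennreal" where "k = indicator (box 0 One)"
  have [measurable]: "k \<in> borel_measurable borel" by (simp add: k_def)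
  have k: "(\<integral>\<^sup>+s. k (- u + s) \<partial>lborel) = 1" for u
    by (subst nn_integral_lborel_translate) (simp_all add: k_def emeasure_lborel_box_eq)
  have k1: "(\<integral>\<^sup>+s. k s \<partial>lborel) = 1" using k[of 0] by simp
  have "(\<integral>\<^sup>+x. F (x + J (l x)) \<partial>lborel)
      = (\<integral>\<^sup>+s. k s * (\<integral>\<^sup>+x. F (x + J (l x)) \<partial>lborel) \<partial>lborel)"
    by (simp add: nn_integral_multc k1)
  also have "\<dots> = (\<integral>\<^sup>+s. (\<integral>\<^sup>+x. k s * F (x + J (l x + s)) \<partial>lborel) \<partial>lborel)"
  proof (rule nn_integral_cong)
    fix s :: 'b
    have "(\<integral>\<^sup>+x. F (x + J (l x)) \<partial>lborel) = (\<integral>\<^sup>+x. F ((J s + x) + J (l (J s + x))) \<partial>lborel)"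
      by (rule nn_integral_lborel_translate[symmetric]) measurable
    also have "\<dots> = (\<integral>\<^sup>+x. F (x + J (l x + s)) \<partial>lborel)"
      unfolding l_inv J_add by (simp add: ac_simps)
    finally show "k s * (\<integral>\<^sup>+x. F (x + J (l x)) \<partial>lborel) = (\<integral>\<^sup>+x. k s * F (x + J (l x + s)) \<partial>lborel)"
      by (simp add: nn_integral_cmult)
  qed
  also have "\<dots> = (\<integral>\<^sup>+x. (\<integral>\<^sup>+s. k s * F (x + J (l x + s)) \<partial>lborel) \<partial>lborel)"
    by (rule lborel_pair.Fubini') measurable
  also have "\<dots> = (\<integral>\<^sup>+x. (\<integral>\<^sup>+s. k (- l x + s) * F (x + J s) \<partial>lborel) \<partial>lborel)"
  proof (rule nn_integral_cong)
    fix x :: 'a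
    show "(\<integral>\<^sup>+s. k s * F (x + J (l x + s)) \<partial>lborel) = (\<integral>\<^sup>+s. k (- l x + s) * F (x + J s) \<partial>lborel)"
      by (subst nn_integral_lborel_translate[where a="l x", symmetric]) auto
  qed
  also have "\<dots> = (\<integral>\<^sup>+s. (\<integral>\<^sup>+x. k (- l x + s) * F (x + J s) \<partial>lborel) \<partial>lborel)"
    by (rule lborel_pair.Fubini') measurable
  also have "\<dots> = (\<integral>\<^sup>+s. (\<integral>\<^sup>+x. k (- l x + s) * F x \<partial>lborel) \<partial>lborel)"
  proof (rule nn_integral_cong)
    fix s :: 'b
    show "(\<integral>\<^sup>+x. k (- l x + s) * F (x + J s) \<partial>lborel) = (\<integral>\<^sup>+x. k (- l x + s) * F x \<partial>lborel)"
      by (subst (2) nn_integral_lborel_translate[where a="J s", symmetric])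
         (auto simp: l_inv add.commute[of _ "J s"])
  qed
  also have "\<dots> = (\<integral>\<^sup>+x. (\<integral>\<^sup>+s. k (- l x + s) * F x \<partial>lborel) \<partial>lborel)"
    by (rule lborel_pair.Fubini') measurable
  also have "\<dots> = (\<integral>\<^sup>+x. F x \<partial>lborel)"
    by (simp add: nn_integral_multc k del: uminus_add_conv_diff)
  finally show ?thesis .
qed

lemma prod_Basis_vec:
  "(\<Prod>j\<in>(Basis :: (real^'n) set). g j) = (\<Prod>i\<in>UNIV. g (axis i 1))"
proof -
  have "(Basis :: (real^'n) set) = range (\<lambda>i. axis i 1)" by (auto simp: Basis_vec_def)
  moreover have "inj (\<lambda>i::'n. axis i (1::real))" by (auto simp: inj_def axis_eq_axis)
  ultimately show ?thesis by (intro prod.reindex_cong[where l="\<lambda>i. axis i 1"]) auto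
qed

text \<open>
Gaussian elimination reduces the claim to diagonal matrices, coordinate transpositions and shears.
\<close>
lemma nn_integral_lborel_linear:
  fixes M :: "real^'n^'n" and F :: "real^'n \<Rightarrow> ennreal"
  assumes "det M \<noteq> 0" and "F \<in> borel_measurable borel"
  shows "(\<integral>\<^sup>+x. F x \<partial>lborel) = ennreal \<bar>det M\<bar> * (\<integral>\<^sup>+x. F (M *v x) \<partial>lborel)"
proof -
  have "det M \<noteq> 0 \<longrightarrow> (\<forall>F :: real^'n \<Rightarrow> ennreal. F \<in> borel_measurable borel \<longrightarrow>
     (\<integral>\<^sup>+x. F x \<partial>lborel) = ennreal \<bar>det M\<bar> * (\<integral>\<^sup>+x. F (M *v x) \<partial>lborel))"
  proof (induction M rule: induct_matrix_elementary_alt)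
    case (1 A B)
    show ?case
    proof (intro impI allI)
      fix F :: "real^'n \<Rightarrow> ennreal"
      assume d: "det (A ** B) \<noteq> 0" and F[measurable]: "F \<in> borel_measurable borel"
      have dA: "det A \<noteq> 0" and dB: "det B \<noteq> 0" using d by (auto simp: det_mul)
      have [measurable]: "(\<lambda>x. A *v x) \<in> borel_measurable borel"
        by (intro borel_measurable_continuous_onI continuous_intros)
      have "(\<integral>\<^sup>+x. F x \<partial>lborel) = ennreal \<bar>det A\<bar> * (\<integral>\<^sup>+x. F (A *v x) \<partial>lborel)"
        using 1(1) dA F by blast
      also have "(\<integral>\<^sup>+x. F (A *v x) \<partial>lborel) = ennreal \<bar>det B\<bar> * (\<integral>\<^sup>+x. F (A *v (B *v x)) \<partial>lborel)"
        using 1(2) dB by simp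
      finally show "(\<integral>\<^sup>+x. F x \<partial>lborel) = ennreal \<bar>det (A ** B)\<bar> * (\<integral>\<^sup>+x. F ((A ** B) *v x) \<partial>lborel)"
        by (simp add: det_mul abs_mult ennreal_mult mult.assoc matrix_vector_mul_assoc)
    qed
  next
    case (2 A i)
    then show ?case using det_zero_row(2) by blast
  next
    case (3 A)
    show ?case
    proof (intro impI allI)
      fix F :: "real^'n \<Rightarrow> ennreal"
      assume d: "det A \<noteq> 0" and F[measurable]: "F \<in> borel_measurable borel"
      define c :: "real^'n \<Rightarrow> real" where "c = (\<lambda>b. b \<bullet> (A *v b))"
      have dd: "det A = (\<Prod>i\<in>UNIV. A $ i $ i)" using 3 by (rule det_diagonal)
      have c_axis: "c (axis i 1) = A $ i $ i" for i
        by (simp add: c_def inner_axis' matrix_vector_mult_basis column_def)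
      have Av: "A *v x = (\<Sum>j\<in>Basis. (c j * (x \<bullet> j)) *\<^sub>R j)" for x
      proof -
        have *: "(A *v x) $ i = A $ i $ i * x $ i" for i
          unfolding matrix_vector_mult_def using 3
          by (simp add: comm_monoid_add_class.sum.remove[where x=i])
        show ?thesis
          by (rule euclidean_eqI)
             (auto simp: inner_sum_left inner_Basis if_distrib cong: if_cong,
              auto simp: Basis_vec_def c_axis inner_axis *)
      qed
      have cn: "c j \<noteq> 0" if "j \<in> Basis" for j
        using that d by (auto simp: Basis_vec_def c_axis dd)
      have pc: "(\<Prod>j\<in>Basis. \<bar>c j\<bar>) = \<bar>det A\<bar>"
        by (simp add: prod_Basis_vec c_axis dd abs_prod)
      have [measurable]: "(\<lambda>x. \<Sum>j\<in>Basis. (c j * (x \<bullet> j)) *\<^sub>R j) \<in> borel_measurable borel" by measurable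
      have "(\<integral>\<^sup>+x. F x \<partial>lborel) = (\<integral>\<^sup>+x. F x \<partial>(density (distr lborel borel (\<lambda>x. 0 + (\<Sum>j\<in>Basis. (c j * (x \<bullet> j)) *\<^sub>R j))) (\<lambda>_. (\<Prod>j\<in>Basis. \<bar>c j\<bar>))))"
        by (subst lborel_affine_euclidean[of c 0, symmetric]) (auto simp: cn)
      also have "\<dots> = ennreal \<bar>det A\<bar> * (\<integral>\<^sup>+x. F (A *v x) \<partial>lborel)"
        by (simp add: nn_integral_density nn_integral_distr nn_integral_cmult pc Av)
      finally show "(\<integral>\<^sup>+x. F x \<partial>lborel) = ennreal \<bar>det A\<bar> * (\<integral>\<^sup>+x. F (A *v x) \<partial>lborel)" .
    qed
  next
    case (4 m n)
    let ?S = "(\<chi> i j. mat 1 $ i $ Transposition.transpose m n j) :: real^'n^'n"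
    have Sv: "?S *v x = (\<chi> i. x $ Transposition.transpose m n i)" for x
    proof -
      have "(\<Sum>j\<in>UNIV. (if i = Transposition.transpose m n j then x $ j else 0)) =
              (\<Sum>j\<in>UNIV. if j = Transposition.transpose m n i then x $ j else 0)" for i
        by (rule sum.cong) (auto simp add: swap_id_eq)
      then show ?thesis
        by (simp add: vec_eq_iff matrix_vector_mult_def mat_def if_distrib [of "\<lambda>x. x * y" for y] cong: if_cong)
    qed
    have dS: "\<bar>det ?S\<bar> = 1"
      using det_permute_columns[of "Transposition.transpose m n" "mat 1 :: real^'n^'n"] 4
      by (simp add: permutes_swap_id sign_swap_id det_I)
    show ?case
    proof (intro impI allI)
      fix F :: "real^'n \<Rightarrow> ennreal"
      assume F[measurable]: "F \<in> borel_measurable borel"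
      have [measurable]: "(\<lambda>x. ?S *v x) \<in> borel_measurable borel"
        by (intro borel_measurable_continuous_onI continuous_intros)
      have "lborel = distr lborel borel (\<lambda>x. ?S *v x)"
      proof (rule lborel_eqI)
        fix a b :: "real^'n"
        assume le: "\<And>j. j \<in> Basis \<Longrightarrow> a \<bullet> j \<le> b \<bullet> j"
        have vim: "(\<lambda>x. ?S *v x) -` box a b = box (?S *v a) (?S *v b)"
          by (auto simp: Sv mem_box_cart) (metis transpose_involutory)+
        have le': "a $ i \<le> b $ i" for i
          using le[of "axis i 1"] by (simp add: inner_axis)
        have "bij (Transposition.transpose m n)" by simp
        then have eq: "(\<Prod>i\<in>UNIV. (b - a) $ Transposition.transpose m n i) = (\<Prod>i\<in>UNIV. (b - a) $ i)"
          by (rule prod.reindex_bij_betw)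
        have le'': "(?S *v a) \<bullet> j \<le> (?S *v b) \<bullet> j" if "j \<in> Basis" for j
          using that le' by (auto simp: Sv Basis_vec_def inner_axis)
        show "emeasure (distr lborel borel (\<lambda>x. ?S *v x)) (box a b) = (\<Prod>j\<in>Basis. (b - a) \<bullet> j)"
          using le'' eq
          by (subst emeasure_distr)
             (simp_all add: vim emeasure_lborel_box_eq prod_Basis_vec inner_axis Sv)
      qed simp
      then have "(\<integral>\<^sup>+x. F x \<partial>lborel) = (\<integral>\<^sup>+x. F x \<partial>distr lborel borel (\<lambda>x. ?S *v x))"
        by simp
      also have "\<dots> = (\<integral>\<^sup>+x. F (?S *v x) \<partial>lborel)"
        by (subst nn_integral_distr) auto
      finally show "(\<integral>\<^sup>+x. F x \<partial>lborel) = ennreal \<bar>det ?S\<bar> * (\<integral>\<^sup>+x. F (?S *v x) \<partial>lborel)"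
        by (simp only: dS) simp
    qed
  next
    case (5 m n)
    let ?S = "(\<chi> i j. of_bool (i = m \<and> j = n \<or> i = j)) :: real^'n^'n"
    have Sv: "?S *v x = x + (x $ n) *\<^sub>R axis m 1" for x
    proof -
      have "(\<Sum>j\<in>UNIV. of_bool (i = m \<and> j = n \<or> i = j) * x $ j)
          = (\<Sum>j\<in>UNIV. (if j = i then x $ j else 0) + (if j = n then (if i = m then x $ j else 0) else 0))" for i
        using 5 by (intro sum.cong) auto
      then show ?thesis
        by (simp add: vec_eq_iff matrix_vector_mult_def sum.distrib axis_def)
    qed
    have "?S = (\<chi> k. if k = m then row m (mat 1) + 1 *s row n (mat 1) else row k (mat 1))"
      using 5 by (auto simp: vec_eq_iff row_def mat_def)
    then have dS: "det ?S = 1"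
      using det_row_operation[OF 5, of "mat 1 :: real^'n^'n" 1] by (simp add: det_I)
    show ?case
    proof (intro impI allI)
      fix F :: "real^'n \<Rightarrow> ennreal"
      assume F[measurable]: "F \<in> borel_measurable borel"
      have "(\<integral>\<^sup>+x. F x \<partial>lborel) = (\<integral>\<^sup>+x. F (x + (\<lambda>s. s *\<^sub>R axis m 1) (x $ n)) \<partial>lborel)"
        by (rule nn_integral_lborel_shear[symmetric]) (use 5 in \<open>auto simp: scaleR_add_left axis_def\<close>)
      then show "(\<integral>\<^sup>+x. F x \<partial>lborel) = ennreal \<bar>det ?S\<bar> * (\<integral>\<^sup>+x. F (?S *v x) \<partial>lborel)"
        by (simp only: dS Sv) simp
    qed
  qed
  then show ?thesis using assms by blast
qed

lemma lborel_linear: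
  fixes M :: "real^'n^'n"
  assumes "det M \<noteq> 0"
  shows "lborel = density (distr lborel borel (\<lambda>x. M *v x)) (\<lambda>_. ennreal \<bar>det M\<bar>)"
proof (rule measure_eqI)
  have [measurable]: "(\<lambda>x. M *v x) \<in> borel_measurable borel"
    by (intro borel_measurable_continuous_onI continuous_intros)
  fix X :: "(real^'n) set" assume X: "X \<in> sets lborel"
  then have [measurable]: "X \<in> sets borel" by simp
  show "emeasure lborel X = emeasure (density (distr lborel borel (\<lambda>x. M *v x)) (\<lambda>_. ennreal \<bar>det M\<bar>)) X"
    using nn_integral_lborel_linear[OF assms, of "indicator X"]
    by (simp add: emeasure_density nn_integral_cmult nn_integral_distr del: nn_integral_indicator)
       (simp only: nn_integral_indicator[OF X])
qed simp

lemma integral_lborel_linear: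
  fixes M :: "real^'n^'n" and F :: "real^'n \<Rightarrow> real"
  assumes "det M \<noteq> 0" and [measurable]: "F \<in> borel_measurable borel"
  shows "(\<integral>x. F x \<partial>lborel) = \<bar>det M\<bar> * (\<integral>x. F (M *v x) \<partial>lborel)"
proof -
  have [measurable]: "(\<lambda>x. M *v x) \<in> borel_measurable borel"
    by (intro borel_measurable_continuous_onI continuous_intros)
  have "(\<integral>x. F x \<partial>lborel) = (\<integral>x. F x \<partial>density (distr lborel borel (\<lambda>x. M *v x)) (\<lambda>_. ennreal \<bar>det M\<bar>))"
    using lborel_linear[OF assms(1)] by simp
  also have "\<dots> = \<bar>det M\<bar> * (\<integral>x. F (M *v x) \<partial>lborel)"
    by (subst integral_density) (auto simp: integral_distr)
  finally show ?thesis .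
qed

section \<open>The standard Gaussian measure\<close>

text \<open>
The Gaussian measure is set up on an arbitrary Euclidean space because it is needed on
\<open>'a\<close> and on \<open>'a \<times> 'a\<close> at the same time.
\<close>
definition gauss_density :: "'a::euclidean_space \<Rightarrow> real" where
  "gauss_density x = (2 * pi) powr (- (real DIM('a) / 2)) * exp (- (norm x)\<^sup>2 / 2)"

definition gauss :: "'a::euclidean_space measure" where
  "gauss = density lborel (\<lambda>x. ennreal (gauss_density x))"

lemma gauss_density_pos: "gauss_density x > 0"
  by (simp add: gauss_density_def)

lemma gauss_density_nonneg [simp]: "gauss_density x \<ge> 0"
  using gauss_density_pos[of x] by simp

lemma borel_measurable_gauss_density [measurable]: "gauss_density \<in> borel_measurable borel"
  unfolding gauss_density_def by measurable

lemma sets_gauss [simp, measurable_cong]: "sets gauss = sets borel"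
  by (simp add: gauss_def)

lemma space_gauss [simp]: "space gauss = UNIV"
  by (simp add: gauss_def)

lemma prod_normal_density:
  fixes x :: "'a::euclidean_space"
  assumes "\<sigma> > 0"
  shows "(\<Prod>b\<in>Basis. normal_density 0 \<sigma> (x \<bullet> b))
    = (1 / sqrt (2 * pi * \<sigma>\<^sup>2)) ^ DIM('a) * exp (- (norm x)\<^sup>2 / (2 * \<sigma>\<^sup>2))"
proof -
  have "(norm x)\<^sup>2 = (\<Sum>b\<in>Basis. (x \<bullet> b)\<^sup>2)"
    by (subst power2_norm_eq_inner, subst euclidean_inner) (simp add: power2_eq_square)
  then have "- (norm x)\<^sup>2 / (2 * \<sigma>\<^sup>2) = (\<Sum>b\<in>Basis. - (x \<bullet> b)\<^sup>2 / (2 * \<sigma>\<^sup>2))"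
    by (simp add: sum_divide_distrib sum_negf)
  then have "exp (- (norm x)\<^sup>2 / (2 * \<sigma>\<^sup>2)) = (\<Prod>b\<in>Basis. exp (- (x \<bullet> b)\<^sup>2 / (2 * \<sigma>\<^sup>2)))"
    by (simp only: exp_sum finite_Basis)
  then show ?thesis
    by (simp add: normal_density_def prod.distrib prod_dividef power_one_over)
qed

lemma nn_integral_prod_normal_density:
  assumes "\<sigma> > 0"
  shows "(\<integral>\<^sup>+x. ennreal (\<Prod>b\<in>Basis. normal_density 0 \<sigma> (x \<bullet> b)) \<partial>(lborel :: 'a::euclidean_space measure)) = 1"
proof -
  have 1: "(\<integral>\<^sup>+x. normal_density 0 \<sigma> x \<partial>lborel) = 1"
    using assms by (subst nn_integral_eq_integral) auto
  have "(\<integral>\<^sup>+x. ennreal (\<Prod>b\<in>Basis. normal_density 0 \<sigma> (x \<bullet> b)) \<partial>(lborel :: 'a measure))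
      = (\<integral>\<^sup>+x. (\<Prod>b\<in>Basis. ennreal (normal_density 0 \<sigma> (x \<bullet> b))) \<partial>(lborel :: 'a measure))"
    by (simp add: prod_ennreal)
  also have "\<dots> = (\<Prod>b\<in>(Basis :: 'a set). (\<integral>\<^sup>+x. normal_density 0 \<sigma> x \<partial>lborel))"
    by (rule nn_integral_lborel_prod) auto
  finally show ?thesis by (simp add: 1)
qed

lemma gauss_density_eq_prod:
  "gauss_density x = (\<Prod>b\<in>Basis. normal_density 0 1 (x \<bullet> b))"
proof -
  have "(2 * pi) powr (- (real n / 2)) = (1 / sqrt (2 * pi)) ^ n" for n
  proof -
    have "(2 * pi) powr (- (real n / 2)) = ((2 * pi) powr (- (1/2))) powr real n"
      by (simp add: powr_powr)
    also have "\<dots> = (1 / sqrt (2 * pi)) ^ n"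
      by (subst powr_realpow) (auto simp: powr_minus powr_half_sqrt divide_simps)
    finally show ?thesis .
  qed
  then show ?thesis
    by (simp add: gauss_density_def prod_normal_density)
qed

lemma prob_space_gauss: "prob_space (gauss :: 'a::euclidean_space measure)"
proof
  show "emeasure (gauss :: 'a measure) (space gauss) = 1"
    unfolding gauss_def
    by (simp add: emeasure_density gauss_density_eq_prod nn_integral_prod_normal_density)
qed

interpretation gauss: prob_space "gauss :: 'a::euclidean_space measure"
  by (rule prob_space_gauss)

lemma integrable_gauss_iff:
  assumes "(f :: 'a::euclidean_space \<Rightarrow> real) \<in> borel_measurable borel"
  shows "integrable gauss f \<longleftrightarrow> integrable lborel (\<lambda>x. gauss_density x * f x)"
  using assms unfolding gauss_def by (subst integrable_density) auto

lemma integral_gauss: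
  assumes "(f :: 'a::euclidean_space \<Rightarrow> real) \<in> borel_measurable borel"
  shows "(\<integral>x. f x \<partial>gauss) = (\<integral>x. gauss_density x * f x \<partial>lborel)"
  using assms unfolding gauss_def by (subst integral_density) auto

text \<open>
All integrability questions below are reduced to this exponential bound: completing the square gives
\<open>c u - u\<^sup>2 / 2 \<le> c\<^sup>2 - u\<^sup>2 / 4\<close>, and \<open>exp (- u\<^sup>2 / 4)\<close> is up to a constant the density of variance \<open>2\<close>.
\<close>
lemma integrable_gauss_exp_norm:
  "integrable (gauss :: 'a::euclidean_space measure) (\<lambda>x. exp (c * norm x))"
proof -
  \<comment> \<open>the normalising constant of the Gaussian density with variance \<open>2\<close>\<close>
  let ?k = "(1 / sqrt (2 * pi * (sqrt 2)\<^sup>2)) ^ DIM('a)"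
  let ?p = "\<lambda>x::'a. \<Prod>b\<in>Basis. normal_density 0 (sqrt 2) (x \<bullet> b)"
  have p: "?p x = ?k * exp (- (norm x)\<^sup>2 / 4)" for x
    by (subst prod_normal_density) auto
  have kpos: "?k > 0" by simp
  have ip: "integrable lborel ?p"
    using nn_integral_prod_normal_density[of "sqrt 2", where 'a='a]
    by (intro integrableI_nonneg) (auto intro!: prod_nonneg simp del: normal_density_def)
  have ie: "integrable lborel (\<lambda>x::'a. exp (- (norm x)\<^sup>2 / 4))"
    using integrable_mult_right[OF ip, of "1 / ?k"] kpos unfolding p by simp
  let ?g = "(2 * pi) powr (- (real DIM('a) / 2))"
  have "integrable lborel (\<lambda>x::'a. gauss_density x * exp (c * norm x))"
  proof (rule Bochner_Integration.integrable_bound)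
    show "integrable lborel (\<lambda>x::'a. (?g * exp (c\<^sup>2)) * exp (- (norm x)\<^sup>2 / 4))"
      by (intro integrable_mult_right ie)
    show "AE x::'a in lborel. norm (gauss_density x * exp (c * norm x))
        \<le> norm ((?g * exp (c\<^sup>2)) * exp (- (norm x)\<^sup>2 / 4))"
    proof (rule AE_I2)
      fix x :: 'a
      have "0 \<le> (norm x / 2 - c)\<^sup>2" by simp
      then have "- (norm x)\<^sup>2 / 2 + c * norm x \<le> c\<^sup>2 + - (norm x)\<^sup>2 / 4"
        by (simp add: power2_eq_square field_simps)
      then have "exp (- (norm x)\<^sup>2 / 2) * exp (c * norm x) \<le> exp (c\<^sup>2) * exp (- (norm x)\<^sup>2 / 4)"
        unfolding exp_add[symmetric] by simp
      then show "norm (gauss_density x * exp (c * norm x))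
        \<le> norm ((?g * exp (c\<^sup>2)) * exp (- (norm x)\<^sup>2 / 4))"
        by (simp add: gauss_density_def abs_mult mult_left_mono mult.assoc)
    qed
  qed measurable
  then show ?thesis by (subst integrable_gauss_iff) auto
qed

lemma integrable_gauss_bound:
  fixes f :: "'a::euclidean_space \<Rightarrow> real"
  assumes "f \<in> borel_measurable borel" and "\<And>x. \<bar>f x\<bar> \<le> K * exp (c * norm x)"
  shows "integrable gauss f"
  by (rule Bochner_Integration.integrable_bound[OF integrable_mult_right[OF integrable_gauss_exp_norm, of K c]])
     (use assms in \<open>auto intro!: AE_I2 intro: order_trans[OF _ abs_ge_self]\<close>)

lemma integral_norm_le:
  fixes f :: "'b \<Rightarrow> real"
  assumes "f \<in> borel_measurable M" and g: "integrable M g" and "\<And>x. norm (f x) \<le> g x"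
  shows "norm (integral\<^sup>L M f) \<le> integral\<^sup>L M g"
proof -
  have f: "integrable M f"
    by (rule Bochner_Integration.integrable_bound[OF g])
       (use assms in \<open>auto intro!: AE_I2 intro: order_trans[OF _ abs_ge_self]\<close>)
  have "norm (integral\<^sup>L M f) \<le> (\<integral>x. norm (f x) \<partial>M)" by (rule integral_norm_bound)
  also have "\<dots> \<le> integral\<^sup>L M g" using f g assms(3) by (intro integral_mono) auto
  finally show ?thesis .
qed

lemma norm_le_exp: "norm x \<le> exp (norm x)"
  using exp_ge_add_one_self[of "norm x"] by linarith

text \<open>
Translating the argument of \<open>F\<close> is the same as tilting the density. This moves the dependence on
\<open>h\<close> from \<open>F\<close>, which is merely measurable, to a smooth factor.
\<close>
lemma integral_gauss_translate:
  fixes F :: "'a::euclidean_space \<Rightarrow> real"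
  assumes [measurable]: "F \<in> borel_measurable borel"
  shows "(\<integral>x. F (x + h) \<partial>gauss) = (\<integral>x. F x * exp (x \<bullet> h - (norm h)\<^sup>2 / 2) \<partial>gauss)"
proof -
  let ?G = "\<lambda>x. gauss_density (x - h) * F x"
  have "(\<integral>x. F (x + h) \<partial>gauss) = (\<integral>x. ?G (h + x) \<partial>lborel)"
    by (subst integral_gauss) (auto simp: add.commute)
  also have "\<dots> = (\<integral>x. ?G x \<partial>distr lborel borel ((+) h))"
    by (subst integral_distr) auto
  also have "\<dots> = (\<integral>x. gauss_density x * (F x * exp (x \<bullet> h - (norm h)\<^sup>2 / 2)) \<partial>lborel)"
  proof -
    have "- (norm (x - h))\<^sup>2 / 2 = - (norm x)\<^sup>2 / 2 + (x \<bullet> h - (norm h)\<^sup>2 / 2)" for x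
      by (simp add: power2_norm_eq_inner inner_diff inner_commute field_simps)
    then have "gauss_density (x - h) = gauss_density x * exp (x \<bullet> h - (norm h)\<^sup>2 / 2)" for x
      by (simp only: gauss_density_def exp_add mult.assoc)
    then show ?thesis by (simp add: lborel_distr_plus ac_simps)
  qed
  also have "\<dots> = (\<integral>x. F x * exp (x \<bullet> h - (norm h)\<^sup>2 / 2) \<partial>gauss)"
    by (subst integral_gauss) auto
  finally show ?thesis .
qed

lemma gauss_tilt_taylor_bound:
  fixes x h :: "'a::euclidean_space"
  assumes "norm h \<le> 1"
  shows "\<bar>exp (x \<bullet> h - (norm h)\<^sup>2 / 2) - 1 - x \<bullet> h\<bar> \<le> (norm h)\<^sup>2 * (4 * exp (2 * norm x))"
proof -
  define a where "a = x \<bullet> h - (norm h)\<^sup>2 / 2"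
  obtain t where t: "\<bar>t\<bar> \<le> \<bar>a\<bar>" "exp a = 1 + a + exp t / 2 * a\<^sup>2"
    using Maclaurin_exp_le[of a 2] by (auto simp: numeral_2_eq_2)
  have "\<bar>a\<bar> \<le> \<bar>x \<bullet> h\<bar> + (norm h)\<^sup>2 / 2"
    unfolding a_def using abs_triangle_ineq4[of "x \<bullet> h" "(norm h)\<^sup>2 / 2"] by simp
  also have "\<dots> \<le> norm x * norm h + norm h"
    using mult_left_mono[OF assms, of "norm h"] Cauchy_Schwarz_ineq2[of x h] norm_ge_zero[of h]
    unfolding power2_eq_square by linarith
  also have "\<dots> = norm h * (norm x + 1)" by (simp add: algebra_simps)
  finally have a1: "\<bar>a\<bar> \<le> norm h * (norm x + 1)" .
  also have "\<dots> \<le> norm x + 1"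
    using assms by (simp add: mult_left_le_one_le)
  finally have a2: "\<bar>a\<bar> \<le> norm x + 1" .
  have "a\<^sup>2 \<le> (norm h * (norm x + 1))\<^sup>2"
    using a1 by (metis abs_ge_zero power2_abs power_mono)
  moreover have "exp t \<le> exp (norm x + 1)" using t(1) a2 by simp
  ultimately have b: "exp t * a\<^sup>2 \<le> exp (norm x + 1) * (norm h * (norm x + 1))\<^sup>2"
    by (intro mult_mono) auto
  have "(norm x + 1)\<^sup>2 \<le> 2 * exp (norm x)"
    using exp_lower_Taylor_quadratic[of "norm x"] by (simp add: power2_eq_square field_simps)
  then have "exp (norm x + 1) * (norm x + 1)\<^sup>2 \<le> exp (norm x + 1) * (2 * exp (norm x))"
    by (intro mult_left_mono) auto
  also have "\<dots> = 2 * exp 1 * exp (2 * norm x)"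
    by (simp add: exp_add mult_exp_exp[symmetric] flip: exp_add)
  also have "\<dots> \<le> 6 * exp (2 * norm x)"
    using exp_le by simp
  finally have c: "exp (norm x + 1) * (norm x + 1)\<^sup>2 \<le> 6 * exp (2 * norm x)" .
  have "exp t * a\<^sup>2 \<le> (norm h)\<^sup>2 * (exp (norm x + 1) * (norm x + 1)\<^sup>2)"
    using b by (simp add: power_mult_distrib ac_simps)
  also have "\<dots> \<le> (norm h)\<^sup>2 * (6 * exp (2 * norm x))"
    using c by (intro mult_left_mono) auto
  finally have d: "exp t * a\<^sup>2 \<le> (norm h)\<^sup>2 * (6 * exp (2 * norm x))" .
  have e: "(norm h)\<^sup>2 / 2 \<le> (norm h)\<^sup>2 * exp (2 * norm x)"
  proof -
    have "1 / 2 \<le> exp (2 * norm x)"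
      using one_le_exp_iff[of "2 * norm x"] norm_ge_zero[of x] by linarith
    from mult_left_mono[OF this zero_le_power2[of "norm h"]] show ?thesis by simp
  qed
  have "exp (x \<bullet> h - (norm h)\<^sup>2 / 2) - 1 - x \<bullet> h = exp t * a\<^sup>2 / 2 - (norm h)\<^sup>2 / 2"
    using t(2) unfolding a_def by simp
  moreover have "\<bar>u / 2 - v\<bar> \<le> 4 * P" if "0 \<le> u" "0 \<le> v" "u \<le> 6 * P" "v \<le> P" for u v P :: real
    using that by (auto simp: abs_le_iff)
  ultimately show ?thesis
    using d e by (simp add: mult.left_commute[of "(norm h)\<^sup>2"])
qed

text \<open>
The average of a merely measurable \<open>F\<close> over the shifted Gaussian is differentiable in the shift: by \<open>integral_gauss_translate\<close> only the tilt
\<open>exp (x \<bullet> h - (norm h)\<^sup>2 / 2)\<close> has to be expanded, and its Taylor remainder is quadratic in \<open>h\<close> with an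
integrable coefficient.
\<close>
lemma gauss_shift_has_derivative:
  fixes F :: "'a::euclidean_space \<Rightarrow> real"
  assumes [measurable]: "F \<in> borel_measurable borel" and K: "\<And>x. \<bar>F x\<bar> \<le> K"
  shows "((\<lambda>h. \<integral>x. F (x + h) \<partial>gauss) has_derivative (\<lambda>h. \<integral>x. F x * (x \<bullet> h) \<partial>gauss)) (at 0)"
proof -
  have K0: "0 \<le> K" using K[of 0] by linarith
  have iF: "integrable gauss F"
    by (rule integrable_gauss_bound[where K=K and c=0]) (use K in auto)
  have iFh: "integrable gauss (\<lambda>x. F x * (x \<bullet> h))" for h
  proof (rule integrable_gauss_bound[where K="K * norm h" and c=1])
    fix x :: 'a
    have "\<bar>F x * (x \<bullet> h)\<bar> \<le> K * (norm x * norm h)"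
      unfolding abs_mult using K K0 Cauchy_Schwarz_ineq2[of x h] by (intro mult_mono) auto
    also have "\<dots> \<le> K * (exp (norm x) * norm h)"
      using K0 norm_le_exp[of x] by (intro mult_left_mono mult_right_mono) auto
    finally show "\<bar>F x * (x \<bullet> h)\<bar> \<le> K * norm h * exp (1 * norm x)" by (simp add: ac_simps)
  qed measurable
  have iFe: "integrable gauss (\<lambda>x. F x * exp (x \<bullet> h - (norm h)\<^sup>2 / 2))" for h
  proof (rule integrable_gauss_bound[where K=K and c="norm h"])
    fix x :: 'a
    have "x \<bullet> h - (norm h)\<^sup>2 / 2 \<le> norm h * norm x"
      using norm_cauchy_schwarz[of x h] zero_le_power2[of "norm h"]
      by (subst mult.commute) linarith
    then show "\<bar>F x * exp (x \<bullet> h - (norm h)\<^sup>2 / 2)\<bar> \<le> K * exp (norm h * norm x)"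
      unfolding abs_mult using K K0 by (intro mult_mono) auto
  qed measurable
  define C where "C = (\<integral>x. K * (4 * exp (2 * norm x)) \<partial>(gauss :: 'a measure))"
  have iC: "integrable (gauss :: 'a measure) (\<lambda>x. K * (4 * exp (2 * norm x)))"
    by (intro integrable_mult_right integrable_gauss_exp_norm)
  show ?thesis
  proof (rule has_derivativeI_sandwich[of 1, where H="\<lambda>h. norm h * C"])
    show "bounded_linear (\<lambda>h. \<integral>x. F x * (x \<bullet> h) \<partial>gauss)"
    proof (rule bounded_linear_intro)
      fix h :: 'a
      have "norm (\<integral>x. F x * (x \<bullet> h) \<partial>gauss) \<le> (\<integral>x. K * exp (1 * norm x) * norm h \<partial>(gauss :: 'a measure))"
      proof (rule integral_norm_le)
        show "integrable gauss (\<lambda>x::'a. K * exp (1 * norm x) * norm h)"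
          by (intro integrable_mult_right integrable_mult_left integrable_gauss_exp_norm)
        fix x :: 'a
        have "\<bar>F x * (x \<bullet> h)\<bar> \<le> K * (norm x * norm h)"
          unfolding abs_mult using K K0 Cauchy_Schwarz_ineq2[of x h] by (intro mult_mono) auto
        also have "\<dots> \<le> K * (exp (norm x) * norm h)"
          using K0 norm_le_exp[of x] by (intro mult_left_mono mult_right_mono) auto
        finally show "norm (F x * (x \<bullet> h)) \<le> K * exp (1 * norm x) * norm h" by simp
      qed measurable
      then show "norm (\<integral>x. F x * (x \<bullet> h) \<partial>gauss)
          \<le> norm h * (\<integral>x. K * exp (1 * norm x) \<partial>(gauss :: 'a measure))"
        by (simp add: mult.commute)
    next
      fix h k :: 'a
      show "(\<integral>x. F x * (x \<bullet> (h + k)) \<partial>gauss) = (\<integral>x. F x * (x \<bullet> h) \<partial>gauss) + (\<integral>x. F x * (x \<bullet> k) \<partial>gauss)"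
        by (subst Bochner_Integration.integral_add[symmetric]) (auto simp: iFh inner_add_right algebra_simps)
    next
      fix c :: real and h :: 'a
      have "(\<lambda>x. F x * (x \<bullet> (c *\<^sub>R h))) = (\<lambda>x. c * (F x * (x \<bullet> h)))" by auto
      then show "(\<integral>x. F x * (x \<bullet> (c *\<^sub>R h)) \<partial>gauss) = c *\<^sub>R (\<integral>x. F x * (x \<bullet> h) \<partial>gauss)"
        by simp
    qed
    show "((\<lambda>h. norm h * C) \<longlongrightarrow> 0) (at 0)"
      by (auto intro!: tendsto_eq_intros)
    fix h :: 'a
    assume "h \<noteq> 0" "dist h 0 < 1"
    then have h: "norm h \<le> 1" "norm h > 0" by auto
    have "(\<integral>x. F (x + h) \<partial>gauss) - (\<integral>x. F (x + 0) \<partial>gauss) - (\<integral>x. F x * (x \<bullet> (h - 0)) \<partial>gauss)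
        = (\<integral>x. F x * (exp (x \<bullet> h - (norm h)\<^sup>2 / 2) - 1 - x \<bullet> h) \<partial>gauss)"
      unfolding integral_gauss_translate[OF assms(1), of h]
      using iF iFh[of h] iFe[of h] by (simp add: algebra_simps flip: Bochner_Integration.integral_diff)
    also have "norm \<dots> \<le> (\<integral>x. (norm h)\<^sup>2 * (K * (4 * exp (2 * norm x))) \<partial>(gauss :: 'a measure))"
    proof (rule integral_norm_le)
      show "integrable gauss (\<lambda>x::'a. (norm h)\<^sup>2 * (K * (4 * exp (2 * norm x))))"
        by (intro integrable_mult_right integrable_gauss_exp_norm)
      fix x :: 'a
      have "\<bar>F x\<bar> * \<bar>exp (x \<bullet> h - (norm h)\<^sup>2 / 2) - 1 - x \<bullet> h\<bar> \<le> K * ((norm h)\<^sup>2 * (4 * exp (2 * norm x)))"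
        using K K0 gauss_tilt_taylor_bound[OF h(1), of x] by (intro mult_mono) auto
      then show "norm (F x * (exp (x \<bullet> h - (norm h)\<^sup>2 / 2) - 1 - x \<bullet> h)) \<le> (norm h)\<^sup>2 * (K * (4 * exp (2 * norm x)))"
        by (simp add: abs_mult ac_simps)
    qed measurable
    also have "\<dots> = (norm h)\<^sup>2 * C"
      unfolding C_def by (rule integral_mult_right_zero)
    finally show "norm ((\<integral>x. F (x + h) \<partial>gauss) - (\<integral>x. F (x + 0) \<partial>gauss) - (\<integral>x. F x * (x \<bullet> (h - 0)) \<partial>gauss)) / norm (h - 0) \<le> norm h * C"
      using h by (simp add: divide_simps power2_eq_square ac_simps)
  qed simp
qed

text \<open>
For constant \<open>F\<close> the average does not depend on the shift, so its derivative vanishes.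
\<close>
lemma integral_gauss_inner: "(\<integral>x. x \<bullet> a \<partial>gauss) = 0"
proof -
  have "((\<lambda>h. \<integral>x. 1 \<partial>(gauss :: 'a measure)) has_derivative (\<lambda>h. \<integral>x. 1 * (x \<bullet> h) \<partial>gauss)) (at (0 :: 'a))"
    by (rule gauss_shift_has_derivative[where K=1]) auto
  moreover have "((\<lambda>h. \<integral>x. 1 \<partial>(gauss :: 'a measure)) has_derivative (\<lambda>h. 0)) (at (0 :: 'a))"
    by simp
  ultimately have "(\<lambda>h. \<integral>x. 1 * (x \<bullet> h) \<partial>gauss) = (\<lambda>h::'a. 0)"
    by (rule has_derivative_unique)
  then show ?thesis by (auto dest: fun_cong[of _ _ a])
qed

lemma cosh_ge_quadratic: "1 + u\<^sup>2 / 2 \<le> cosh (u::real)"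
proof -
  have "\<exists>c\<ge>0. exp v = 1 + v + v\<^sup>2 / 2 + v ^ 3 / 6 + c" for v :: real
  proof -
    obtain t where "exp v = (\<Sum>m<4. v ^ m / fact m) + exp t / fact 4 * v ^ 4"
      using Maclaurin_exp_le[of v 4] by auto
    moreover have "0 \<le> exp t / fact 4 * v ^ 4" by simp
    ultimately show ?thesis
      by (intro exI[of _ "exp t / fact 4 * v ^ 4"]) (simp add: eval_nat_numeral)
  qed
  from this[of u] this[of "- u"] show ?thesis
    by (auto simp: cosh_field_def)
qed

text \<open>
The Gaussian has covariance at most the identity, which is all that the Bessel argument below needs.
From the moment generating function and \<open>cosh v \<ge> 1 + v\<^sup>2 / 2\<close> with \<open>v = sqrt s * (x \<bullet> a)\<close>, the second
moment is at most \<open>(exp (s * (norm a)\<^sup>2 / 2) - 1) / (s / 2)\<close>, which tends to \<open>(norm a)\<^sup>2\<close> as \<open>s\<close> tends to \<open>0\<close>.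
\<close>
lemma integral_gauss_inner_square_le:
  fixes a :: "'a::euclidean_space"
  shows "(\<integral>x. (x \<bullet> a)\<^sup>2 \<partial>gauss) \<le> (norm a)\<^sup>2"
proof -
  let ?M = "\<integral>x. (x \<bullet> a)\<^sup>2 \<partial>gauss"
  have exp_int: "integrable gauss (\<lambda>x. exp (x \<bullet> b))" for b :: 'a
    by (rule integrable_gauss_bound[where K=1 and c="norm b"])
       (use norm_cauchy_schwarz[of _ b] in \<open>auto simp: mult.commute\<close>)
  have mgf: "(\<integral>x. exp (x \<bullet> b) \<partial>gauss) = exp ((norm b)\<^sup>2 / 2)" for b :: 'a
  proof -
    have "1 = (\<integral>x. exp (x \<bullet> b - (norm b)\<^sup>2 / 2) \<partial>gauss)"
      using integral_gauss_translate[of "\<lambda>_. 1" b] by (simp add: gauss.prob_space[simplified])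
    then show ?thesis by (simp only: exp_diff integral_divide_zero) (simp add: field_simps)
  qed
  have sq_int: "integrable gauss (\<lambda>x. (x \<bullet> a)\<^sup>2)"
  proof (rule Bochner_Integration.integrable_bound)
    show "integrable gauss (\<lambda>x. exp (x \<bullet> a) + exp (x \<bullet> (- a)))"
      by (intro Bochner_Integration.integrable_add exp_int)
    have "(x \<bullet> a)\<^sup>2 \<le> exp (x \<bullet> a) + exp (x \<bullet> (- a))" for x
      using cosh_ge_quadratic[of "x \<bullet> a"] by (simp add: cosh_field_def)
    then show "AE x in gauss. norm ((x \<bullet> a)\<^sup>2) \<le> norm (exp (x \<bullet> a) + exp (x \<bullet> (- a)))"
      by (intro AE_I2) (simp add: abs_of_nonneg add_nonneg_nonneg)
  qed measurable
  have ineq: "1 + s / 2 * ?M \<le> exp (s * (norm a)\<^sup>2 / 2)" if s: "0 < s" for s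
  proof -
    let ?b = "sqrt s *\<^sub>R a"
    have "1 + s / 2 * ?M = (\<integral>x. 1 + s / 2 * (x \<bullet> a)\<^sup>2 \<partial>gauss)"
      using sq_int by (simp add: gauss.prob_space[simplified])
    also have "\<dots> \<le> (\<integral>x. (exp (x \<bullet> ?b) + exp (x \<bullet> (- ?b))) / 2 \<partial>gauss)"
    proof (rule integral_mono)
      show "integrable gauss (\<lambda>x. 1 + s / 2 * (x \<bullet> a)\<^sup>2)" using sq_int by simp
      show "integrable gauss (\<lambda>x. (exp (x \<bullet> ?b) + exp (x \<bullet> (- ?b))) / 2)"
        by (intro integrable_divide Bochner_Integration.integrable_add exp_int)
      show "1 + s / 2 * (x \<bullet> a)\<^sup>2 \<le> (exp (x \<bullet> ?b) + exp (x \<bullet> (- ?b))) / 2" for x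
        using cosh_ge_quadratic[of "x \<bullet> ?b"] s by (simp add: cosh_field_def power_mult_distrib)
    qed
    also have "\<dots> = (exp ((norm ?b)\<^sup>2 / 2) + exp ((norm (- ?b))\<^sup>2 / 2)) / 2"
      unfolding mgf[symmetric] by (simp only: integral_divide_zero Bochner_Integration.integral_add[OF exp_int exp_int])
    also have "\<dots> = exp (s * (norm a)\<^sup>2 / 2)"
      using s by (simp add: power_mult_distrib)
    finally show ?thesis .
  qed
  have "((\<lambda>s. (exp (s * (norm a)\<^sup>2 / 2) - 1) / (s / 2)) \<longlongrightarrow> (norm a)\<^sup>2) (at_right 0)"
  proof -
    have "((\<lambda>s. exp (s * (norm a)\<^sup>2 / 2)) has_real_derivative (norm a)\<^sup>2 / 2) (at 0)"
      by (auto intro!: derivative_eq_intros)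
    then have "((\<lambda>s. (exp (s * (norm a)\<^sup>2 / 2) - 1) / s) \<longlongrightarrow> (norm a)\<^sup>2 / 2) (at_right 0)"
      by (auto simp: DERIV_def intro: filterlim_mono at_le)
    from tendsto_mult[OF tendsto_const[of 2] this] show ?thesis
      by (simp add: field_simps)
  qed
  moreover have "eventually (\<lambda>s. ?M \<le> (exp (s * (norm a)\<^sup>2 / 2) - 1) / (s / 2)) (at_right (0::real))"
    unfolding eventually_at_right_field
    by (rule exI[of _ 1]) (use ineq in \<open>auto simp: field_simps\<close>)
  ultimately show ?thesis
    by (rule tendsto_lowerbound) simp
qed

lemma DERIV_integral:
  fixes F :: "real \<Rightarrow> 'b \<Rightarrow> real"
  assumes int: "\<And>t. integrable M (F t)"
    and der: "\<And>t x. ((\<lambda>t. F t x) has_real_derivative F' t x) (at t)"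
    and bound: "\<And>t x. \<bar>F' t x\<bar> \<le> w x" and w: "integrable M w"
  shows "((\<lambda>t. \<integral>x. F t x \<partial>M) has_real_derivative (\<integral>x. F' t x \<partial>M)) (at t)"
  unfolding DERIV_def tendsto_at_iff_sequentially comp_def
proof (intro allI impI)
  fix X :: "nat \<Rightarrow> real"
  assume X: "\<forall>i. X i \<in> UNIV - {0}" "X \<longlonglongrightarrow> 0"
  let ?q = "\<lambda>i x. (F (t + X i) x - F t x) / X i"
  have lim: "(\<lambda>i. ?q i x) \<longlonglongrightarrow> F' t x" for x
    using der[of x t] X unfolding DERIV_def tendsto_at_iff_sequentially comp_def by blast
  have "(\<lambda>i. \<integral>x. ?q i x \<partial>M) \<longlonglongrightarrow> (\<integral>x. F' t x \<partial>M)"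
  proof (rule integral_dominated_convergence[OF _ _ w])
    show meas: "?q i \<in> borel_measurable M" for i
      using int by (auto dest: borel_measurable_integrable)
    show "F' t \<in> borel_measurable M"
      using borel_measurable_LIMSEQ_real[OF lim meas] .
    show "AE x in M. (\<lambda>i. ?q i x) \<longlonglongrightarrow> F' t x" using lim by simp
    fix i
    have "norm (?q i x) \<le> w x" for x
    proof -
      have "\<bar>F (t + X i) x - F t x\<bar> \<le> w x * \<bar>(t + X i) - t\<bar>"
        using field_differentiable_bound[of UNIV "\<lambda>t. F t x" "\<lambda>t. F' t x" "w x" "t + X i" t] der bound
        by auto
      then show ?thesis using X(1) by (simp add: abs_divide divide_simps)
    qed
    then show "AE x in M. norm (?q i x) \<le> w x" by simp
  qed
  moreover have "(\<integral>x. ?q i x \<partial>M) = ((\<integral>x. F (t + X i) x \<partial>M) - (\<integral>x. F t x \<partial>M)) / X i" for i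
    by (simp only: integral_divide_zero Bochner_Integration.integral_diff[OF int int])
  ultimately show "(\<lambda>i. ((\<integral>x. F (t + X i) x \<partial>M) - (\<integral>x. F t x \<partial>M)) / X i) \<longlonglongrightarrow> (\<integral>x. F' t x \<partial>M)"
    by (simp only:)
qed

text \<open>
Both sides are the derivative at \<open>s = 0\<close> of the integral of \<open>F (x + s *\<^sub>R a)\<close>: the left one by
differentiating the tilted density, the right one by differentiating \<open>F\<close>. The derivative of \<open>F\<close> is
taken in the single direction \<open>a\<close> because the Poincare inequality applies this to a product whose
second factor is constant along \<open>a\<close> but otherwise merely continuous.
\<close>
lemma gauss_integration_by_parts:
  fixes F G :: "'a::euclidean_space \<Rightarrow> real"
  assumes [measurable]: "F \<in> borel_measurable borel"
    and F: "\<And>x. \<bar>F x\<bar> \<le> K" and G: "\<And>x. \<bar>G x\<bar> \<le> L"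
    and der: "\<And>x. ((\<lambda>s. F (x + s *\<^sub>R a)) has_real_derivative G x) (at 0)"
  shows "(\<integral>x. F x * (x \<bullet> a) \<partial>gauss) = (\<integral>x. G x \<partial>gauss)"
proof -
  have der': "((\<lambda>s. F (x + s *\<^sub>R a)) has_real_derivative G (x + s *\<^sub>R a)) (at s)" for x s
    using der[of "x + s *\<^sub>R a"] unfolding DERIV_def by (simp add: scaleR_add_left add.assoc)
  have "((\<lambda>s. \<integral>x. F (x + s *\<^sub>R a) \<partial>gauss) has_real_derivative (\<integral>x. G (x + 0 *\<^sub>R a) \<partial>gauss)) (at 0)"
  proof (rule DERIV_integral[OF _ der'])
    show "integrable gauss (\<lambda>x. F (x + s *\<^sub>R a))" for s
      by (rule integrable_gauss_bound[where K=K and c=0]) (use F in auto)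
    show "\<bar>G (x + s *\<^sub>R a)\<bar> \<le> L" for s x by (rule G)
  qed simp
  moreover have "((\<lambda>s. \<integral>x. F (x + s *\<^sub>R a) \<partial>gauss) has_real_derivative (\<integral>x. F x * (x \<bullet> a) \<partial>gauss)) (at 0)"
  proof -
    have "((\<lambda>s. \<integral>x. F (x + s *\<^sub>R a) \<partial>gauss) has_derivative (\<lambda>s. \<integral>x. F x * (x \<bullet> (s *\<^sub>R a)) \<partial>gauss)) (at 0)"
    proof (rule has_derivative_compose[of "\<lambda>s. s *\<^sub>R a" "\<lambda>s. s *\<^sub>R a" 0 UNIV "\<lambda>h. \<integral>x. F (x + h) \<partial>gauss"])
      show "((\<lambda>s. s *\<^sub>R a) has_derivative (\<lambda>s. s *\<^sub>R a)) (at 0)"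
        by (auto intro!: derivative_eq_intros)
      show "((\<lambda>h. \<integral>x. F (x + h) \<partial>gauss) has_derivative (\<lambda>h. \<integral>x. F x * (x \<bullet> h) \<partial>gauss)) (at (0 *\<^sub>R a))"
        using gauss_shift_has_derivative[OF assms(1) F] by simp
    qed
    moreover have "(\<integral>x. F x * (x \<bullet> (s *\<^sub>R a)) \<partial>gauss) = (\<integral>x. F x * (x \<bullet> a) \<partial>gauss) * s" for s
    proof -
      have "(\<lambda>x. F x * (x \<bullet> (s *\<^sub>R a))) = (\<lambda>x. F x * (x \<bullet> a) * s)" by auto
      then show ?thesis by simp
    qed
    ultimately show ?thesis by (simp add: has_field_derivative_def)
  qed
  ultimately show ?thesis using DERIV_unique by fastforce
qed

section \<open>Rotation invariance and the Poincare inequalities\<close>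

text \<open>
On a product of Euclidean spaces \<open>borel\<close> coincides with the product sigma-algebra, but the two are
different terms; \<open>gauss\<close> carries the former, so the projections are declared measurable for it.
\<close>
lemma borel_measurable_fst_prod [measurable]:
  "fst \<in> borel_measurable (borel :: ('a::topological_space \<times> 'b::topological_space) measure)"
  by (intro borel_measurable_continuous_onI continuous_intros)

lemma borel_measurable_snd_prod [measurable]:
  "snd \<in> borel_measurable (borel :: ('a::topological_space \<times> 'b::topological_space) measure)"
  by (intro borel_measurable_continuous_onI continuous_intros)

lemma gauss_density_Pair: "gauss_density (x, y) = gauss_density x * gauss_density y"
proof -
  have "- (real (DIM('a) + DIM('b)) / 2) = - (real DIM('a) / 2) + - (real DIM('b) / 2)"
    by (simp add: field_simps)
  then show ?thesis for x :: "'a::euclidean_space" and y :: "'b::euclidean_space"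
    by (simp only: gauss_density_def DIM_prod powr_add norm_Pair exp_add[symmetric])
       (simp add: exp_add[symmetric] field_simps)
qed

lemma gauss_pair:
  "(gauss :: ('a::euclidean_space \<times> 'b::euclidean_space) measure) = gauss \<Otimes>\<^sub>M gauss"
proof -
  have "(gauss :: 'a measure) \<Otimes>\<^sub>M (gauss :: 'b measure)
     = density (lborel \<Otimes>\<^sub>M lborel) (\<lambda>(x, y). ennreal (gauss_density x) * ennreal (gauss_density y))"
    unfolding gauss_def
    by (rule pair_measure_density)
       (auto simp: lborel.sigma_finite_measure_axioms gauss_def[symmetric] gauss.sigma_finite_measure_axioms)
  also have "\<dots> = gauss"
    unfolding lborel_prod gauss_def case_prod_beta'
    by (intro density_cong AE_I2) (auto simp: gauss_density_Pair ennreal_mult)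
  finally show ?thesis by simp
qed

lemma integral_gauss_product:
  fixes f :: "'a::euclidean_space \<Rightarrow> real" and g :: "'b::euclidean_space \<Rightarrow> real"
  assumes f: "integrable gauss f" and g: "integrable gauss g"
  shows "(\<integral>z. f (fst z) * g (snd z) \<partial>gauss) = (\<integral>x. f x \<partial>gauss) * (\<integral>y. g y \<partial>gauss)"
proof -
  interpret pair_sigma_finite "gauss :: 'a measure" "gauss :: 'b measure" ..
  have [measurable]: "f \<in> borel_measurable borel" "g \<in> borel_measurable borel"
    using f g by (auto dest: borel_measurable_integrable)
  have "integrable (gauss \<Otimes>\<^sub>M gauss) (\<lambda>z. f (fst z) * g (snd z))"
    by (rule Fubini_integrable) (use f g in \<open>auto simp: abs_mult intro!: integrable_mult_left\<close>)
  from integral_fst'[OF this] show ?thesis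
    by (simp add: gauss_pair)
qed

text \<open>
A rotation by an angle with sine \<open>s\<close> and cosine \<open>c\<close> is the product of three shears, the outer two
with slope \<open>- t\<close> and the middle one with slope \<open>s\<close>, where \<open>t = s / (1 + c)\<close> is the tangent of
half the angle.
\<close>
lemma nn_integral_lborel_rotate:
  fixes G :: "'a::euclidean_space \<times> 'a \<Rightarrow> ennreal"
  assumes G: "G \<in> borel_measurable borel" and sc: "s\<^sup>2 + c\<^sup>2 = 1" "0 \<le> c"
  shows "(\<integral>\<^sup>+z. G (c *\<^sub>R fst z - s *\<^sub>R snd z, s *\<^sub>R fst z + c *\<^sub>R snd z) \<partial>lborel) = (\<integral>\<^sup>+z. G z \<partial>lborel)"
proof -
  note [measurable] = G
  define t where "t = s / (1 + c)"
  have st: "s * t = 1 - c" "t * (1 + c) = s"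
  proof -
    show "t * (1 + c) = s" using sc(2) by (simp add: t_def)
    have "s * s = (1 - c) * (1 + c)" using sc(1) by (simp add: power2_eq_square algebra_simps)
    then show "s * t = 1 - c" using sc(2) by (simp add: t_def field_simps)
  qed
  have sh1: "(\<integral>\<^sup>+z. H (z + (\<lambda>v. (- t *\<^sub>R v, 0)) (snd z)) \<partial>lborel) = (\<integral>\<^sup>+z. H z \<partial>lborel)"
    if "H \<in> borel_measurable borel" for H :: "'a \<times> 'a \<Rightarrow> ennreal"
    using that
    by (intro nn_integral_lborel_shear)
       (auto simp: algebra_simps intro!: borel_measurable_continuous_onI continuous_intros)
  have sh2: "(\<integral>\<^sup>+z. H (z + (\<lambda>v. (0, s *\<^sub>R v)) (fst z)) \<partial>lborel) = (\<integral>\<^sup>+z. H z \<partial>lborel)"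
    if "H \<in> borel_measurable borel" for H :: "'a \<times> 'a \<Rightarrow> ennreal"
    using that
    by (intro nn_integral_lborel_shear)
       (auto simp: algebra_simps intro!: borel_measurable_continuous_onI continuous_intros)
  let ?S1 = "\<lambda>z::'a \<times> 'a. z + (\<lambda>v. (- t *\<^sub>R v, 0)) (snd z)"
  let ?S2 = "\<lambda>z::'a \<times> 'a. z + (\<lambda>v. (0, s *\<^sub>R v)) (fst z)"
  have [measurable]: "?S1 \<in> borel_measurable borel" "?S2 \<in> borel_measurable borel"
    by (intro borel_measurable_continuous_onI continuous_intros)+
  have eq: "?S1 (?S2 (?S1 z)) = (c *\<^sub>R fst z - s *\<^sub>R snd z, s *\<^sub>R fst z + c *\<^sub>R snd z)" for z
  proof (cases z)
    case (Pair x y)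
    have a: "x + - t *\<^sub>R y + - t *\<^sub>R (s *\<^sub>R x + c *\<^sub>R y) = (1 - s * t) *\<^sub>R x - (t * (1 + c)) *\<^sub>R y"
      by (simp add: algebra_simps)
    have b: "y + s *\<^sub>R (x + - t *\<^sub>R y) = s *\<^sub>R x + (1 - s * t) *\<^sub>R y"
      by (simp add: algebra_simps)
    have b': "y + s *\<^sub>R (x + - t *\<^sub>R y) = s *\<^sub>R x + c *\<^sub>R y" unfolding b st by simp
    show ?thesis unfolding Pair
      by (simp only: fst_conv snd_conv add_Pair add_0_left add_0_right b' a) (simp add: st)
  qed
  have "(\<integral>\<^sup>+z. G z \<partial>lborel) = (\<integral>\<^sup>+z. G (?S1 z) \<partial>lborel)" by (rule sh1[symmetric]) fact
  also have "\<dots> = (\<integral>\<^sup>+z. G (?S1 (?S2 z)) \<partial>lborel)" by (rule sh2[symmetric]) measurable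
  also have "\<dots> = (\<integral>\<^sup>+z. G (?S1 (?S2 (?S1 z))) \<partial>lborel)" by (rule sh1[symmetric]) measurable
  finally show ?thesis unfolding eq by simp
qed

text \<open>
If \<open>X\<close> and \<open>Y\<close> are independent standard Gaussian vectors and \<open>s\<^sup>2 + c\<^sup>2 = 1\<close>, then \<open>s X + c Y\<close> is again standard
Gaussian, since it is a component of a rotation of \<open>(X, Y)\<close>.
\<close>
lemma distr_gauss_combination:
  assumes sc: "s\<^sup>2 + c\<^sup>2 = 1" "0 \<le> c"
  shows "distr (gauss :: ('a::euclidean_space \<times> 'a) measure) borel (\<lambda>z. s *\<^sub>R fst z + c *\<^sub>R snd z) = gauss"
proof (rule measure_eqI)
  let ?R = "\<lambda>z::'a \<times> 'a. (c *\<^sub>R fst z - s *\<^sub>R snd z, s *\<^sub>R fst z + c *\<^sub>R snd z)"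
  fix X assume X: "X \<in> sets (distr (gauss :: ('a \<times> 'a) measure) borel (\<lambda>z. s *\<^sub>R fst z + c *\<^sub>R snd z))"
  then have [measurable]: "X \<in> sets borel" by simp
  have [measurable]: "(\<lambda>z::'a \<times> 'a. s *\<^sub>R fst z + c *\<^sub>R snd z) \<in> borel_measurable borel"
    by (intro borel_measurable_continuous_onI continuous_intros)
  have gauss_R: "gauss_density (?R z) = gauss_density z" for z
  proof -
    have "(norm (?R z))\<^sup>2 = (s\<^sup>2 + c\<^sup>2) * ((norm (fst z))\<^sup>2 + (norm (snd z))\<^sup>2)"
      unfolding norm_Pair real_sqrt_pow2_iff real_sqrt_pow2[OF add_nonneg_nonneg[OF zero_le_power2 zero_le_power2]]
      by (simp add: power2_norm_eq_inner inner_simps inner_commute)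
         (simp add: power2_eq_square algebra_simps)
    also have "\<dots> = (norm z)\<^sup>2" using sc(1) by (cases z) (simp add: norm_Pair)
    finally show ?thesis by (simp add: gauss_density_def)
  qed
  have "emeasure (distr (gauss :: ('a \<times> 'a) measure) borel (\<lambda>z. s *\<^sub>R fst z + c *\<^sub>R snd z)) X
      = (\<integral>\<^sup>+z. indicator X (s *\<^sub>R fst z + c *\<^sub>R snd z) \<partial>(gauss :: ('a \<times> 'a) measure))"
    by (subst nn_integral_indicator[symmetric], use X in simp, subst nn_integral_distr) auto
  also have "\<dots> = (\<integral>\<^sup>+z. gauss_density (?R z) * indicator X (snd (?R z)) \<partial>lborel)"
    unfolding gauss_def
    by (subst nn_integral_density) (auto simp: gauss_R intro!: nn_integral_cong split: split_indicator)
  also have "\<dots> = (\<integral>\<^sup>+z. gauss_density z * indicator X (snd z) \<partial>(lborel :: ('a \<times> 'a) measure))"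
    by (rule nn_integral_lborel_rotate[OF _ sc, where G="\<lambda>z. gauss_density z * indicator X (snd z)"]) measurable
  also have "\<dots> = (\<integral>\<^sup>+z. indicator X (snd z) \<partial>(gauss :: ('a \<times> 'a) measure))"
    unfolding gauss_def
    by (subst nn_integral_density) (auto intro!: nn_integral_cong split: split_indicator)
  also have "\<dots> = (\<integral>\<^sup>+z. indicator X (snd z) \<partial>((gauss :: 'a measure) \<Otimes>\<^sub>M (gauss :: 'a measure)))"
    by (simp add: gauss_pair)
  also have "\<dots> = emeasure gauss X"
    by (subst gauss.nn_integral_fst[symmetric]) (auto simp: gauss.emeasure_space_1[simplified])
  finally show "emeasure (distr (gauss :: ('a \<times> 'a) measure) borel (\<lambda>z. s *\<^sub>R fst z + c *\<^sub>R snd z)) X = emeasure gauss X" .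
qed simp

lemma integral_gauss_combination:
  fixes H :: "'a::euclidean_space \<Rightarrow> real"
  assumes sc: "s\<^sup>2 + c\<^sup>2 = 1" "0 \<le> c" and [measurable]: "H \<in> borel_measurable borel"
  shows "(\<integral>z. H (s *\<^sub>R fst z + c *\<^sub>R snd z) \<partial>gauss) = (\<integral>x. H x \<partial>gauss)"
  by (subst (2) distr_gauss_combination[OF sc, symmetric], subst integral_distr)
     (auto intro!: borel_measurable_continuous_onI continuous_intros)

lemma GDERIV_along_line:
  assumes "GDERIV f x :> g"
  shows "((\<lambda>s. f (x + s *\<^sub>R v)) has_real_derivative (g \<bullet> v)) (at 0)"
proof -
  have "((\<lambda>s. x + s *\<^sub>R v) has_derivative (\<lambda>s. s *\<^sub>R v)) (at 0)"
    by (auto intro!: derivative_eq_intros)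
  from has_derivative_compose[OF this, of f "\<lambda>h. h \<bullet> g"] assms show ?thesis
    unfolding has_field_derivative_def gderiv_def by (simp add: inner_commute mult_commute_abs)
qed

text \<open>
The sharp Gaussian Poincare inequality, by interpolation. Let \<open>X\<close>, \<open>Y\<close> be independent standard
Gaussians and \<open>Z t = sin t X + cos t Y\<close>, which moves from \<open>Y\<close> to \<open>X\<close>. Put \<open>\<psi> t = E (f X * f (Z t))\<close>, so that
\<open>\<psi> (pi / 2) - \<psi> 0\<close> is the variance of \<open>f X\<close>. The derivative of \<open>\<psi>\<close> is \<open>E (f X * (g (Z t) \<bullet> Z' t))\<close>. In
the direction \<open>(cos t i, - sin t i)\<close> of the product space, in which \<open>Z' t \<bullet> i\<close> is the coordinate,
\<open>Z t\<close> stays constant. Integration by parts in this direction therefore differentiates only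
\<open>f X\<close>, no second derivatives of \<open>f\<close> occur, and the derivative of \<open>\<psi>\<close> turns out to be
\<open>cos t * E (g X \<bullet> g (Z t))\<close>. Since \<open>Z t\<close> and \<open>X\<close> have the same law, this is at most \<open>cos t * E (g X \<bullet> g X)\<close>, and \<open>cos\<close> has
integral \<open>1\<close> over the quarter period.
\<close>
lemma gauss_poincare:
  fixes f :: "'a::euclidean_space \<Rightarrow> real" and g :: "'a \<Rightarrow> 'a"
  assumes der: "\<And>x. GDERIV f x :> g x" and cont: "continuous_on UNIV g"
    and K: "\<And>x. \<bar>f x\<bar> \<le> K" and L: "\<And>x. norm (g x) \<le> L"
  shows "(\<integral>x. (f x)\<^sup>2 \<partial>gauss) - (\<integral>x. f x \<partial>gauss)\<^sup>2 \<le> (\<integral>x. g x \<bullet> g x \<partial>gauss)"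
proof -
  have K0: "0 \<le> K" using K[of 0] by linarith
  have L0: "0 \<le> L" using L[of 0] norm_ge_zero[of "g 0"] by linarith
  have fder: "(f has_derivative (\<lambda>h. h \<bullet> g x)) (at x)" for x
    using der[of x] by (simp add: gderiv_def)
  have "continuous_on UNIV f"
    using has_derivative_continuous[OF fder] by (simp add: continuous_on_eq_continuous_within)
  then have [measurable]: "f \<in> borel_measurable borel" by (rule borel_measurable_continuous_onI)
  have [measurable]: "g \<in> borel_measurable borel" using cont by (rule borel_measurable_continuous_onI)
  let ?X = "\<lambda>t (z :: 'a \<times> 'a). sin t *\<^sub>R fst z + cos t *\<^sub>R snd z"
  have [measurable]: "?X t \<in> borel_measurable borel" for t
    by (intro borel_measurable_continuous_onI continuous_intros)
  have [measurable]: "(\<lambda>z. z \<bullet> p) \<in> borel_measurable borel" for p :: "'a \<times> 'a"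
    by (intro borel_measurable_continuous_onI continuous_intros)
  let ?X' = "\<lambda>t (z :: 'a \<times> 'a). cos t *\<^sub>R fst z - sin t *\<^sub>R snd z"
  let ?psi = "\<lambda>t. \<integral>z. f (fst z) * f (?X t z) \<partial>gauss"
  let ?psi' = "\<lambda>t. \<integral>z. f (fst z) * (g (?X t z) \<bullet> ?X' t z) \<partial>gauss"
  let ?D = "\<integral>x. g x \<bullet> g x \<partial>gauss"
  have bnd: "\<bar>f (fst z) * (g (?X t z) \<bullet> ?X' t z)\<bar> \<le> (2 * K * L) * exp (1 * norm z)" for t z
  proof -
    have "norm (?X' t z) \<le> \<bar>cos t\<bar> * norm (fst z) + \<bar>sin t\<bar> * norm (snd z)"
      using norm_triangle_ineq4[of "cos t *\<^sub>R fst z" "sin t *\<^sub>R snd z"] by simp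
    also have "\<dots> \<le> 1 * norm z + 1 * norm z"
      using norm_fst_le[of "fst z" "snd z"] norm_snd_le[of "snd z" "fst z"]
      by (intro add_mono mult_mono) auto
    also have "\<dots> \<le> 2 * exp (norm z)" using norm_le_exp[of z] by simp
    finally have "norm (?X' t z) \<le> 2 * exp (norm z)" .
    then have "\<bar>g (?X t z) \<bullet> ?X' t z\<bar> \<le> L * (2 * exp (norm z))"
      using L0 L by (intro order_trans[OF Cauchy_Schwarz_ineq2] mult_mono) auto
    then have "\<bar>f (fst z)\<bar> * \<bar>g (?X t z) \<bullet> ?X' t z\<bar> \<le> K * (L * (2 * exp (norm z)))"
      using K K0 by (intro mult_mono) auto
    then show ?thesis by (simp add: abs_mult ac_simps)
  qed
  have psi_der: "(?psi has_real_derivative ?psi' t) (at t)" for t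
  proof (rule DERIV_integral[OF _ _ bnd])
    show "integrable gauss (\<lambda>z. f (fst z) * f (?X t z))" for t
      by (rule integrable_gauss_bound[where K="K * K" and c=0])
         (use K K0 in \<open>auto simp: abs_mult intro!: mult_mono\<close>)
    show "integrable gauss (\<lambda>z::'a \<times> 'a. (2 * K * L) * exp (1 * norm z))"
      by (intro integrable_mult_right integrable_gauss_exp_norm)
    fix t and z :: "'a \<times> 'a"
    have "((\<lambda>t. ?X t z) has_derivative (\<lambda>h. h *\<^sub>R ?X' t z)) (at t)"
      by (auto intro!: derivative_eq_intros simp: algebra_simps)
    from has_derivative_compose[OF this fder]
    have "((\<lambda>t. f (?X t z)) has_real_derivative (g (?X t z) \<bullet> ?X' t z)) (at t)"
      unfolding has_field_derivative_def by (simp add: inner_commute mult_commute_abs)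
    then show "((\<lambda>t. f (fst z) * f (?X t z)) has_real_derivative f (fst z) * (g (?X t z) \<bullet> ?X' t z)) (at t)"
      by (rule DERIV_cmult)
  qed
  have psi'_le: "?psi' t \<le> cos t * ?D" if t: "0 \<le> cos t" for t
  proof -
    have sc: "(sin t)\<^sup>2 + (cos t)\<^sup>2 = 1" "(1::real)\<^sup>2 + 0\<^sup>2 = 1" by auto
    have gi: "\<bar>g x \<bullet> i\<bar> \<le> L" if "i \<in> Basis" for x i
      using Basis_le_norm[OF that, of "g x"] L[of x] by linarith
    have int_i: "integrable gauss (\<lambda>z. f (fst z) * (g (?X t z) \<bullet> i) * (z \<bullet> (cos t *\<^sub>R i, - sin t *\<^sub>R i)))"
      if i: "i \<in> Basis" for i
    proof (rule integrable_gauss_bound[where K="K * L * 2" and c=1])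
      fix z :: "'a \<times> 'a"
      have "norm (cos t *\<^sub>R i, - sin t *\<^sub>R i) = 1"
        using i by (simp add: norm_Pair)
      then have "\<bar>z \<bullet> (cos t *\<^sub>R i, - sin t *\<^sub>R i)\<bar> \<le> 2 * exp (norm z)"
        using Cauchy_Schwarz_ineq2[of z "(cos t *\<^sub>R i, - sin t *\<^sub>R i)"] norm_le_exp[of z] norm_ge_zero[of z]
        by auto
      then have "\<bar>f (fst z)\<bar> * \<bar>g (?X t z) \<bullet> i\<bar> * \<bar>z \<bullet> (cos t *\<^sub>R i, - sin t *\<^sub>R i)\<bar> \<le> K * L * (2 * exp (norm z))"
        using K K0 L0 gi[OF i] by (intro mult_mono) auto
      then show "\<bar>f (fst z) * (g (?X t z) \<bullet> i) * (z \<bullet> (cos t *\<^sub>R i, - sin t *\<^sub>R i))\<bar> \<le> K * L * 2 * exp (1 * norm z)"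
        by (simp add: abs_mult ac_simps)
    qed measurable
    have int_gg: "integrable gauss (\<lambda>z. (cos t * (g (fst z) \<bullet> i)) * (g (?X t z) \<bullet> i))" if i: "i \<in> Basis" for i
    proof (rule integrable_gauss_bound[where K="1 * L * L" and c=0])
      fix z :: "'a \<times> 'a"
      have "\<bar>cos t\<bar> * \<bar>g (fst z) \<bullet> i\<bar> * \<bar>g (?X t z) \<bullet> i\<bar> \<le> 1 * L * L"
        using L0 gi[OF i] by (intro mult_mono) auto
      then show "\<bar>(cos t * (g (fst z) \<bullet> i)) * (g (?X t z) \<bullet> i)\<bar> \<le> 1 * L * L * exp (0 * norm z)"
        by (simp add: abs_mult)
    qed measurable
    have gg: "\<bar>g x \<bullet> g y\<bar> \<le> L * L" for x y
      using L L0 by (intro order_trans[OF Cauchy_Schwarz_ineq2] mult_mono) auto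
    have int_b: "integrable gauss (\<lambda>z. g (p z) \<bullet> g (q z))"
      if [measurable]: "p \<in> borel_measurable borel" "q \<in> borel_measurable borel" for p q :: "'a \<times> 'a \<Rightarrow> 'a"
      by (rule integrable_gauss_bound[where K="L * L" and c=0]) (use gg in auto)
    have "?psi' t = (\<integral>z. (\<Sum>i\<in>Basis. f (fst z) * (g (?X t z) \<bullet> i) * (z \<bullet> (cos t *\<^sub>R i, - sin t *\<^sub>R i))) \<partial>gauss)"
    proof (rule Bochner_Integration.integral_cong)
      fix z :: "'a \<times> 'a"
      have "?X' t z \<bullet> i = z \<bullet> (cos t *\<^sub>R i, - sin t *\<^sub>R i)" for i
        by (cases z) (simp add: inner_diff_left)
      then show "f (fst z) * (g (?X t z) \<bullet> ?X' t z)
        = (\<Sum>i\<in>Basis. f (fst z) * (g (?X t z) \<bullet> i) * (z \<bullet> (cos t *\<^sub>R i, - sin t *\<^sub>R i)))"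
        by (subst euclidean_inner) (simp add: sum_distrib_left mult.assoc)
    qed simp
    also have "\<dots> = (\<Sum>i\<in>Basis. \<integral>z. f (fst z) * (g (?X t z) \<bullet> i) * (z \<bullet> (cos t *\<^sub>R i, - sin t *\<^sub>R i)) \<partial>gauss)"
      by (intro Bochner_Integration.integral_sum int_i)
    also have "\<dots> = (\<Sum>i\<in>Basis. \<integral>z. (cos t * (g (fst z) \<bullet> i)) * (g (?X t z) \<bullet> i) \<partial>gauss)"
    proof (intro sum.cong refl gauss_integration_by_parts)
      fix i :: 'a assume i: "i \<in> Basis"
      show "\<bar>f (fst z) * (g (?X t z) \<bullet> i)\<bar> \<le> K * L" for z
        unfolding abs_mult using K K0 gi[OF i] by (intro mult_mono) auto
      show "\<bar>(cos t * (g (fst z) \<bullet> i)) * (g (?X t z) \<bullet> i)\<bar> \<le> 1 * L * L" for z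
        unfolding abs_mult using L0 gi[OF i] by (intro mult_mono) auto
      fix z :: "'a \<times> 'a"
      have X: "?X t (z + s *\<^sub>R (cos t *\<^sub>R i, - sin t *\<^sub>R i)) = ?X t z" for s
        by (simp add: algebra_simps)
      have "((\<lambda>s. f (fst z + s *\<^sub>R (cos t *\<^sub>R i)) * (g (?X t z) \<bullet> i)) has_real_derivative
          (g (fst z) \<bullet> (cos t *\<^sub>R i)) * (g (?X t z) \<bullet> i)) (at 0)"
        by (rule DERIV_cmult_right[OF GDERIV_along_line[OF der]])
      then show "((\<lambda>s. f (fst (z + s *\<^sub>R (cos t *\<^sub>R i, - sin t *\<^sub>R i))) * (g (?X t (z + s *\<^sub>R (cos t *\<^sub>R i, - sin t *\<^sub>R i))) \<bullet> i))
          has_real_derivative (cos t * (g (fst z) \<bullet> i)) * (g (?X t z) \<bullet> i)) (at 0)"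
        unfolding X by simp
    qed measurable
    also have "\<dots> = (\<integral>z. cos t * (g (fst z) \<bullet> g (?X t z)) \<partial>gauss)"
      by (subst Bochner_Integration.integral_sum[symmetric], erule int_gg)
         (simp add: euclidean_inner[of "g _" "g _"] sum_distrib_left mult.assoc)
    also have "\<dots> \<le> (\<integral>z. cos t * ((g (fst z) \<bullet> g (fst z) + g (?X t z) \<bullet> g (?X t z)) / 2) \<partial>gauss)"
    proof (rule integral_mono)
      show "integrable gauss (\<lambda>z. cos t * (g (fst z) \<bullet> g (?X t z)))"
        by (intro integrable_mult_right int_b) measurable
      show "integrable gauss (\<lambda>z. cos t * ((g (fst z) \<bullet> g (fst z) + g (?X t z) \<bullet> g (?X t z)) / 2))"
        by (intro integrable_mult_right integrable_divide Bochner_Integration.integrable_add int_b) measurable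
      fix z :: "'a \<times> 'a"
      have "0 \<le> (g (fst z) - g (?X t z)) \<bullet> (g (fst z) - g (?X t z))" by simp
      then have "g (fst z) \<bullet> g (?X t z) \<le> (g (fst z) \<bullet> g (fst z) + g (?X t z) \<bullet> g (?X t z)) / 2"
        by (simp add: inner_diff inner_commute)
      then show "cos t * (g (fst z) \<bullet> g (?X t z)) \<le> cos t * ((g (fst z) \<bullet> g (fst z) + g (?X t z) \<bullet> g (?X t z)) / 2)"
        using t by (rule mult_left_mono)
    qed
    also have "\<dots> = cos t * (((\<integral>z. g (fst z) \<bullet> g (fst z) \<partial>(gauss :: ('a \<times> 'a) measure)) + (\<integral>z. g (?X t z) \<bullet> g (?X t z) \<partial>gauss)) / 2)"
    proof -
      have "integrable gauss (\<lambda>z::'a \<times> 'a. g (fst z) \<bullet> g (fst z))" "integrable gauss (\<lambda>z. g (?X t z) \<bullet> g (?X t z))"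
        by (rule int_b; measurable)+
      then show ?thesis
        by (simp only: integral_mult_right_zero integral_divide_zero Bochner_Integration.integral_add)
    qed
    also have "(\<integral>z. g (?X t z) \<bullet> g (?X t z) \<partial>gauss) = ?D"
      using integral_gauss_combination[OF sc(1) t, of "\<lambda>x. g x \<bullet> g x"] by simp
    also have "(\<integral>z. g (fst z) \<bullet> g (fst z) \<partial>(gauss :: ('a \<times> 'a) measure)) = ?D"
      using integral_gauss_combination[OF sc(2) order_refl, of "\<lambda>x. g x \<bullet> g x"] by simp
    finally show ?thesis by simp
  qed
  \<comment> \<open>\<open>sin\<close> is the antiderivative of the bound \<open>cos\<close>.\<close>
  have "?psi (pi / 2) - sin (pi / 2) * ?D \<le> ?psi 0 - sin 0 * ?D"
  proof (rule DERIV_nonpos_imp_nonincreasing[of 0 "pi/2" "\<lambda>t. ?psi t - sin t * ?D"])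
    fix t :: real assume t: "0 \<le> t" "t \<le> pi / 2"
    have "((\<lambda>t. ?psi t - sin t * ?D) has_real_derivative ?psi' t - cos t * ?D) (at t)"
      by (intro DERIV_diff psi_der DERIV_cmult_right DERIV_sin)
    moreover have "?psi' t - cos t * ?D \<le> 0"
      using psi'_le[OF cos_ge_zero] t by auto
    ultimately show "\<exists>y. ((\<lambda>t. ?psi t - sin t * ?D) has_real_derivative y) (at t) \<and> y \<le> 0" by blast
  qed simp
  moreover have "?psi (pi / 2) = (\<integral>x. (f x)\<^sup>2 \<partial>gauss)"
    using integral_gauss_combination[of 1 0 "\<lambda>x. (f x)\<^sup>2"] by (simp add: power2_eq_square)
  moreover have "?psi 0 = (\<integral>x. f x \<partial>gauss)\<^sup>2"
  proof -
    have "integrable gauss f"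
      by (rule integrable_gauss_bound[where K=K and c=0]) (use K in auto)
    from integral_gauss_product[OF this this] show ?thesis by (simp add: power2_eq_square)
  qed
  ultimately show ?thesis by simp
qed

text \<open>
This is Bessel's inequality for the coordinate functions in \<open>L\<^sup>2\<close> of the Gaussian measure: the
vector \<open>G\<close> collects the first-order coefficients of \<open>F\<close>, and the square of
\<open>F - E F - x \<bullet> G\<close> has a nonnegative integral.
\<close>
lemma gauss_reverse_poincare:
  fixes F :: "'a::euclidean_space \<Rightarrow> real"
  assumes [measurable]: "F \<in> borel_measurable borel" and K: "\<And>x. \<bar>F x\<bar> \<le> K"
    and G: "\<And>a. (\<integral>x. F x * (x \<bullet> a) \<partial>gauss) = G \<bullet> a"
  shows "G \<bullet> G \<le> (\<integral>x. (F x)\<^sup>2 \<partial>gauss) - (\<integral>x. F x \<partial>gauss)\<^sup>2"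
proof -
  have K0: "0 \<le> K" using K[of 0] by linarith
  let ?m = "\<integral>x. F x \<partial>gauss"
  have iF: "integrable gauss F"
    by (rule integrable_gauss_bound[where K=K and c=0]) (use K in auto)
  have iF2: "integrable gauss (\<lambda>x. (F x)\<^sup>2)"
    by (rule integrable_gauss_bound[where K="K\<^sup>2" and c=0])
       (use K in \<open>auto simp: abs_le_square_iff[symmetric] abs_of_nonneg[OF K0]\<close>)
  have abs_inner_le: "\<bar>x \<bullet> G\<bar> \<le> norm G * exp (norm x)" for x
    using Cauchy_Schwarz_ineq2[of x G] mult_right_mono[OF norm_le_exp[of x], of "norm G"]
    by (simp add: mult.commute)
  have iG: "integrable gauss (\<lambda>x. x \<bullet> G)"
    by (rule integrable_gauss_bound[where K="norm G" and c=1]) (use abs_inner_le in auto)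
  have iFG: "integrable gauss (\<lambda>x. F x * (x \<bullet> G))"
    by (rule integrable_gauss_bound[where K="K * norm G" and c=1])
       (use K K0 abs_inner_le in \<open>auto simp: abs_mult mult.assoc intro!: mult_mono\<close>)
  have iG2: "integrable gauss (\<lambda>x. (x \<bullet> G)\<^sup>2)"
  proof (rule integrable_gauss_bound[where K="(norm G)\<^sup>2" and c=2])
    fix x :: 'a
    have "\<bar>x \<bullet> G\<bar>\<^sup>2 \<le> (norm G * exp (norm x))\<^sup>2"
      using abs_inner_le by (intro power_mono) auto
    then show "\<bar>(x \<bullet> G)\<^sup>2\<bar> \<le> (norm G)\<^sup>2 * exp (2 * norm x)"
      by (simp add: power_mult_distrib exp_double)
  qed measurable
  have "0 \<le> (\<integral>x. (F x - ?m - x \<bullet> G)\<^sup>2 \<partial>gauss)"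
    by (rule Bochner_Integration.integral_nonneg) simp
  also have "\<dots> = (\<integral>x. (F x)\<^sup>2 + ?m\<^sup>2 + (x \<bullet> G)\<^sup>2 - 2 * ?m * F x - 2 * (F x * (x \<bullet> G)) + 2 * ?m * (x \<bullet> G) \<partial>gauss)"
    by (intro Bochner_Integration.integral_cong) (auto simp: power2_eq_square algebra_simps)
  also have "\<dots> = (\<integral>x. (F x)\<^sup>2 \<partial>gauss) + ?m\<^sup>2 + (\<integral>x. (x \<bullet> G)\<^sup>2 \<partial>gauss) - 2 * ?m * ?m - 2 * (G \<bullet> G)"
    using iF iF2 iG iFG iG2
    by (simp add: gauss.prob_space[simplified] G integral_gauss_inner)
  also have "\<dots> \<le> (\<integral>x. (F x)\<^sup>2 \<partial>gauss) - ?m\<^sup>2 - G \<bullet> G"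
    using integral_gauss_inner_square_le[of G]
    by (simp add: power2_eq_square dot_square_norm)
  finally show ?thesis by simp
qed

section \<open>Exponentials of nilpotent matrices\<close>

text \<open>
This is the form in which powers occur in \<open>matrix_exp\<close>.
\<close>
abbreviation mat_power :: "real^'n^'n \<Rightarrow> nat \<Rightarrow> real^'n^'n::finite" where
  "mat_power N k \<equiv> (((**) N) ^^ k) (mat 1)"

lemma bounded_bilinear_matrix_mult:
  "bounded_bilinear ((**) :: real^'n^'n \<Rightarrow> real^'n^'n \<Rightarrow> real^'n^'n)"
  unfolding bilinear_conv_bounded_bilinear[symmetric]
  by (auto simp: bilinear_def vec_eq_iff matrix_matrix_mult_def sum.distrib sum_distrib_left algebra_simps
      intro!: linearI)

lemmas matrix_mult_simps =
  bounded_bilinear.add_left[OF bounded_bilinear_matrix_mult]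
  bounded_bilinear.add_right[OF bounded_bilinear_matrix_mult]
  bounded_bilinear.scaleR_left[OF bounded_bilinear_matrix_mult]
  bounded_bilinear.scaleR_right[OF bounded_bilinear_matrix_mult]
  bounded_bilinear.minus_left[OF bounded_bilinear_matrix_mult]
  bounded_bilinear.minus_right[OF bounded_bilinear_matrix_mult]
  bounded_bilinear.sum_left[OF bounded_bilinear_matrix_mult]
  bounded_bilinear.sum_right[OF bounded_bilinear_matrix_mult]

lemma bounded_linear_transpose: "bounded_linear (transpose :: real^'n^'n \<Rightarrow> real^'n^'n)"
  unfolding linear_conv_bounded_linear[symmetric]
  by (rule linearI) (auto simp: transpose_def vec_eq_iff)

lemma mat_power_commute: "N ** mat_power N k = mat_power N k ** N"
proof (induction k)
  case (Suc k)
  then show ?case using arg_cong[OF Suc, of "(**) N"] by (simp add: matrix_mul_assoc)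
qed simp

lemma mat_power_scaleR: "mat_power (c *\<^sub>R N) k = c ^ k *\<^sub>R mat_power N k"
  by (induction k) (simp_all add: matrix_mult_simps)

lemma transpose_mat_power: "transpose (mat_power N k) = mat_power (transpose N) k"
  by (induction k) (simp_all add: matrix_transpose_mul mat_power_commute)

lemma mat_power_transpose_eq_0:
  assumes "mat_power N k = 0"
  shows "mat_power (transpose N) k = 0"
  by (simp only: transpose_mat_power[symmetric] assms linear_0[OF bounded_linear.linear[OF bounded_linear_transpose]])

lemma mat_power_eq_0_mono:
  assumes "mat_power N (Suc r) = 0" and "r < k"
  shows "mat_power N k = 0"
proof -
  have "mat_power N (n + Suc r) = 0" for n
  proof (induction n)
    case (Suc n)
    then show ?case
      by (simp only: add_Suc funpow.simps(2) comp_apply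
          bounded_bilinear.zero_right[OF bounded_bilinear_matrix_mult])
  qed (use assms(1) in simp)
  from this[of "k - Suc r"] assms(2) show ?thesis by simp
qed

text \<open>
For a nilpotent matrix the exponential series is a finite sum, so no convergence questions arise.
\<close>
lemma matrix_exp_nilpotent:
  assumes "mat_power N (Suc r) = 0"
  shows "matrix_exp (c *\<^sub>R N) = (\<Sum>k\<le>r. (c ^ k / fact k) *\<^sub>R mat_power N k)"
proof -
  have "(\<Sum>k. (1 / fact k) *\<^sub>R mat_power (c *\<^sub>R N) k) = (\<Sum>k\<le>r. (1 / fact k) *\<^sub>R mat_power (c *\<^sub>R N) k)"
    by (rule suminf_finite) (use mat_power_eq_0_mono[OF assms] in \<open>auto simp: mat_power_scaleR not_le\<close>)
  then show ?thesis by (simp add: matrix_exp_def mat_power_scaleR)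
qed

lemma matrix_exp_commute:
  assumes "mat_power N (Suc r) = 0"
  shows "N ** matrix_exp (s *\<^sub>R N) = matrix_exp (s *\<^sub>R N) ** N"
  by (simp add: matrix_exp_nilpotent[OF assms] matrix_mult_simps mat_power_commute)

lemma has_vector_derivative_matrix_exp:
  assumes "mat_power N (Suc r) = 0"
  shows "((\<lambda>s. matrix_exp (s *\<^sub>R N)) has_vector_derivative N ** matrix_exp (s *\<^sub>R N)) (at s)"
proof -
  have 1: "((\<lambda>s. s ^ k / fact k) has_real_derivative (real k * s ^ (k - 1) / fact k)) (at s)" for k
    by (auto intro!: derivative_eq_intros)
  have "((\<lambda>s. \<Sum>k\<le>r. (s ^ k / fact k) *\<^sub>R mat_power N k) has_vector_derivative
      (\<Sum>k\<le>r. (real k * s ^ (k - 1) / fact k) *\<^sub>R mat_power N k)) (at s)"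
    by (intro has_vector_derivative_sum)
       (use has_vector_derivative_scaleR[OF 1 has_vector_derivative_const] in auto)
  also have "(\<Sum>k\<le>r. (real k * s ^ (k - 1) / fact k) *\<^sub>R mat_power N k)
      = (\<Sum>k\<le>Suc r. (real k * s ^ (k - 1) / fact k) *\<^sub>R mat_power N k)"
    using assms by (simp del: funpow.simps(2))
  also have "\<dots> = (\<Sum>k\<le>r. (s ^ k / fact k) *\<^sub>R mat_power N (Suc k))"
  proof -
    have "real (Suc k) * s ^ (Suc k - 1) / fact (Suc k) = s ^ k / fact k" for k
      by (simp del: of_nat_Suc)
    then show ?thesis unfolding sum.atMost_Suc_shift by (simp del: funpow.simps fact_Suc of_nat_Suc)
  qed
  also have "\<dots> = N ** (\<Sum>k\<le>r. (s ^ k / fact k) *\<^sub>R mat_power N k)"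
    by (simp add: matrix_mult_simps)
  finally show ?thesis by (simp only: matrix_exp_nilpotent[OF assms])
qed

lemma matrix_exp_zero: "matrix_exp (0 :: real^'n^'n) = mat 1"
proof -
  have *: "mat_power (0 *\<^sub>R 0 :: real^'n^'n) (Suc 0) = 0"
    by (simp add: bounded_bilinear.zero_left[OF bounded_bilinear_matrix_mult])
  show ?thesis using matrix_exp_nilpotent[of 0 0 0] * by simp
qed

text \<open>
The left-hand side has derivative zero in \<open>s\<close> and takes the value on the right at \<open>s = 0\<close>.
The choice \<open>a = 0\<close> gives the inverse, and from it follows the law of exponents.
\<close>
lemma matrix_exp_cancel_aux:
  assumes nil: "mat_power N (Suc r) = 0"
  shows "matrix_exp ((a + s) *\<^sub>R N) ** matrix_exp (- s *\<^sub>R N) = matrix_exp (a *\<^sub>R N)"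
proof -
  let ?e = "\<lambda>s. matrix_exp (s *\<^sub>R N)"
  let ?F = "\<lambda>s. ?e (a + s) ** ?e (- s)"
  note D = has_vector_derivative_matrix_exp[OF nil]
  have "(?F has_vector_derivative 0) (at s)" for s
  proof -
    have 1: "((\<lambda>s. ?e (a + s)) has_vector_derivative N ** ?e (a + s)) (at s)"
    proof -
      have "((\<lambda>s. a + s) has_vector_derivative 1) (at s)"
        unfolding has_real_derivative_iff_has_vector_derivative[symmetric]
        by (auto intro!: derivative_eq_intros)
      from vector_diff_chain_at[OF this D] show ?thesis by (simp add: o_def)
    qed
    have 2: "((\<lambda>s. ?e (- s)) has_vector_derivative - (N ** ?e (- s))) (at s)"
    proof -
      have "((\<lambda>s. - s) has_vector_derivative - 1) (at s)"
        unfolding has_real_derivative_iff_has_vector_derivative[symmetric]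
        by (auto intro!: derivative_eq_intros)
      from vector_diff_chain_at[OF this D] show ?thesis by (simp add: o_def)
    qed
    have "(?F has_vector_derivative (?e (a + s) ** (- (N ** ?e (- s))) + (N ** ?e (a + s)) ** ?e (- s))) (at s)"
      by (rule bounded_bilinear.has_vector_derivative[OF bounded_bilinear_matrix_mult 1 2])
    moreover have "?e (a + s) ** (- (N ** ?e (- s))) + (N ** ?e (a + s)) ** ?e (- s) = 0"
      unfolding matrix_exp_commute[OF nil, of "a + s"]
      by (simp only: matrix_mult_simps matrix_mul_assoc) simp
    ultimately show ?thesis by simp
  qed
  then have "?F s = ?F 0" for s
    using has_vector_derivative_zero_constant[of UNIV ?F] by (metis UNIV_I convex_UNIV)
  from this[of s] show ?thesis by (simp add: matrix_exp_zero)
qed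

lemma matrix_exp_inverse:
  assumes "mat_power N (Suc r) = 0"
  shows "matrix_exp (s *\<^sub>R N) ** matrix_exp (- s *\<^sub>R N) = mat 1"
  using matrix_exp_cancel_aux[OF assms, of 0 s] by (simp add: matrix_exp_zero)

lemma matrix_exp_add:
  assumes "mat_power N (Suc r) = 0"
  shows "matrix_exp ((a + s) *\<^sub>R N) = matrix_exp (a *\<^sub>R N) ** matrix_exp (s *\<^sub>R N)"
proof -
  have "matrix_exp (a *\<^sub>R N) ** matrix_exp (s *\<^sub>R N)
      = matrix_exp ((a + s) *\<^sub>R N) ** (matrix_exp (- s *\<^sub>R N) ** matrix_exp (s *\<^sub>R N))"
    by (simp only: matrix_exp_cancel_aux[OF assms, of a s, symmetric] matrix_mul_assoc)
  also have "matrix_exp (- s *\<^sub>R N) ** matrix_exp (s *\<^sub>R N) = mat 1"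
    using matrix_exp_inverse[OF assms, of "- s"] by simp
  finally show ?thesis by simp
qed

lemma transpose_matrix_exp:
  assumes "mat_power N (Suc r) = 0"
  shows "transpose (matrix_exp (s *\<^sub>R N)) = matrix_exp (s *\<^sub>R transpose N)"
proof -
  have "mat_power (transpose N) (Suc r) = 0"
    by (rule mat_power_transpose_eq_0[OF assms])
  then show ?thesis
    by (simp only: matrix_exp_nilpotent[OF assms] matrix_exp_nilpotent
        linear_sum[OF bounded_linear.linear[OF bounded_linear_transpose]] transpose_scalar transpose_mat_power)
qed

text \<open>
In a product over a permutation \<open>p\<close> with only nonzero factors, \<open>l (p i) \<le> l i\<close> for all \<open>i\<close>, and
strictly so where \<open>p\<close> moves \<open>i\<close>. As \<open>p\<close> does not change the sum of the values of \<open>l\<close>, only the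
identity remains. The level function \<open>l\<close> stands in for a linear order of the index type.
\<close>
lemma det_unitriangular:
  fixes M :: "real^'n^'n" and l :: "'n \<Rightarrow> nat"
  assumes diag: "\<And>i. M $ i $ i = 1"
    and tri: "\<And>i j. i \<noteq> j \<Longrightarrow> M $ i $ j \<noteq> 0 \<Longrightarrow> l j < l i"
  shows "det M = 1"
proof -
  have "(\<Prod>i\<in>UNIV. M $ i $ p i) = 0" if p: "p permutes UNIV" and ne: "p \<noteq> id" for p
  proof (rule ccontr)
    assume "(\<Prod>i\<in>UNIV. M $ i $ p i) \<noteq> 0"
    then have nz: "M $ i $ p i \<noteq> 0" for i by auto
    have le: "l (p i) \<le> l i" for i
      using tri[OF _ nz[of i]] by (cases "p i = i") (auto simp: less_imp_le)
    obtain i where i: "p i \<noteq> i" using ne by (auto simp: fun_eq_iff)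
    have "(\<Sum>i\<in>UNIV. l (p i)) < (\<Sum>i\<in>UNIV. l i)"
      using le tri[OF _ nz[of i]] i by (intro sum_strict_mono_ex1) auto
    moreover have "(\<Sum>i\<in>UNIV. l (p i)) = (\<Sum>i\<in>UNIV. l i)"
      using permutes_bij[OF p] by (rule sum.reindex_bij_betw)
    ultimately show False by simp
  qed
  then have "det M = (\<Sum>p\<in>{p. p permutes UNIV}. if p = id then of_int (sign p) * (\<Prod>i\<in>UNIV. M $ i $ p i) else 0)"
    unfolding det_def by (intro sum.cong) auto
  also have "\<dots> = 1"
    by (simp add: finite_permutations permutes_id sign_id diag)
  finally show ?thesis .
qed

lemma inner_transpose:
  fixes M :: "real^'n^'m"
  shows "(transpose M *v x) \<bullet> y = x \<bullet> (M *v y)"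
  by (simp add: dot_lmul_matrix)

text \<open>
Gram-Schmidt orthogonalisation for the inner product \<open>u \<bullet> (C *v v)\<close>: as long as fewer vectors than the
dimension have been found, some nonzero vector is orthogonal to all their images under \<open>C\<close>.
\<close>
lemma pos_def_orthonormal_set:
  fixes C :: "real^'n^'n"
  assumes sym: "transpose C = C" and pos: "\<And>v. v \<noteq> 0 \<Longrightarrow> 0 < v \<bullet> (C *v v)"
    and "k \<le> CARD('n)"
  shows "\<exists>S. finite S \<and> card S = k \<and> (\<forall>u\<in>S. \<forall>v\<in>S. u \<bullet> (C *v v) = (if u = v then 1 else 0))"
  using assms(3)
proof (induction k)
  case 0
  show ?case by (intro exI[of _ "{}"]) auto
next
  case (Suc k)
  then obtain S where S: "finite S" "card S = k"
    "\<And>u v. u \<in> S \<Longrightarrow> v \<in> S \<Longrightarrow> u \<bullet> (C *v v) = (if u = v then 1 else 0)" by auto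
  have sym': "u \<bullet> (C *v v) = v \<bullet> (C *v u)" for u v
    using inner_transpose[of C u v] unfolding sym by (simp add: inner_commute)
  have "dim ((*v) C ` S) \<le> card ((*v) C ` S)" using S(1) by (intro dim_le_card') auto
  also have "\<dots> \<le> k" using S(1,2) card_image_le by blast
  finally have "dim ((*v) C ` S) < DIM(real^'n)" using Suc.prems by simp
  then obtain x where x: "x \<noteq> 0" "\<And>y. y \<in> span ((*v) C ` S) \<Longrightarrow> orthogonal x y"
    using orthogonal_to_subspace_exists by blast
  have orth: "x \<bullet> (C *v u) = 0" if "u \<in> S" for u
    using x(2)[OF span_base] that by (auto simp: orthogonal_def)
  define q where "q = x \<bullet> (C *v x)"
  have q: "q > 0" using pos[OF x(1)] by (simp add: q_def)
  define w where "w = (1 / sqrt q) *\<^sub>R x"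
  have ww: "w \<bullet> (C *v w) = 1"
    using q by (simp add: w_def matrix_vector_mult_scaleR q_def[symmetric])
  have wu: "w \<bullet> (C *v u) = 0" if "u \<in> S" for u
    using orth[OF that] by (simp add: w_def)
  have "w \<notin> S" using ww wu by auto
  then show ?case
    using S ww wu sym' by (intro exI[of _ "insert w S"]) auto
qed

text \<open>
If the columns of \<open>R\<close> are orthonormal with respect to \<open>C\<close>, then \<open>transpose R ** C ** R\<close> is the identity, and
\<open>L = C ** R\<close>, the inverse of \<open>transpose R\<close>, is a factor as required.
\<close>
lemma pos_def_factorization:
  fixes C :: "real^'n^'n"
  assumes sym: "transpose C = C" and pos: "\<And>v. v \<noteq> 0 \<Longrightarrow> 0 < v \<bullet> (C *v v)"
  shows "\<exists>L. C = L ** transpose L \<and> det L \<noteq> 0"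
proof -
  obtain S where S: "finite S" "card S = CARD('n)"
    "\<And>u v. u \<in> S \<Longrightarrow> v \<in> S \<Longrightarrow> u \<bullet> (C *v v) = (if u = v then 1 else 0)"
    using pos_def_orthonormal_set[OF sym pos, of "CARD('n)"] by auto
  obtain b where b: "bij_betw b (UNIV :: 'n set) S"
    using finite_same_card_bij[of "UNIV :: 'n set" S] S by auto
  define R :: "real^'n^'n" where "R = (\<chi> i j. b j $ i)"
  have col: "R *v axis j 1 = b j" for j
    by (simp add: R_def matrix_vector_mult_basis column_def vec_eq_iff)
  have 1: "transpose R ** (C ** R) = mat 1"
  proof -
    have "(transpose R ** (C ** R)) $ i $ j = mat 1 $ i $ j" for i j
    proof -
      have "(transpose R ** (C ** R)) $ i $ j = axis i 1 \<bullet> ((transpose R ** (C ** R)) *v axis j 1)"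
        by (simp add: inner_axis' matrix_vector_mult_basis column_def)
      also have "\<dots> = (R *v axis i 1) \<bullet> (C *v (R *v axis j 1))"
        by (simp only: matrix_vector_mul_assoc[symmetric] inner_commute[of "axis i 1"] inner_transpose)
           (simp add: inner_commute)
      also have "\<dots> = (if i = j then 1 else 0)"
        unfolding col using S(3)[of "b i" "b j"] b
        by (auto simp: bij_betw_def inj_eq)
      finally show ?thesis by (simp add: mat_def)
    qed
    then show ?thesis by (simp add: vec_eq_iff)
  qed
  then have 2: "(C ** R) ** transpose R = mat 1"
    using matrix_left_right_inverse by blast
  have "det (transpose R) * det (C ** R) = 1"
    using arg_cong[OF 1, of det] by (simp only: det_mul det_I)
  then have "det (C ** R) \<noteq> 0" by auto
  moreover have "(C ** R) ** transpose (C ** R) = C"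
    by (simp only: matrix_transpose_mul sym matrix_mul_assoc 2 matrix_mul_lid)
  ultimately show ?thesis by metis
qed

text \<open>
A repeated column lowers the rank, so full column rank forces distinct and independent columns.
\<close>
lemma full_column_rank_kernel:
  fixes M :: "real mat"
  assumes M: "M \<in> carrier_mat n c" and rank: "vec_space.rank n M = c"
    and v: "v \<in> carrier_vec c" "M *\<^sub>v v = 0\<^sub>v n"
  shows "v = 0\<^sub>v c"
proof -
  interpret vec_space "TYPE(real)" n .
  have dist: "distinct (cols M)"
  proof (rule ccontr)
    assume nd: "\<not> distinct (cols M)"
    obtain S where S: "maximal S (\<lambda>T. T \<subseteq> set (cols M) \<and> lin_indpt T)"
      using maximal_exists[of "(\<lambda>T. T \<subseteq> set (cols M) \<and> lin_indpt T)" "card (set (cols M))" "{}"]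
      by (meson List.finite_set card_mono empty_iff empty_subsetI finite_lin_indpt2 rev_finite_subset)
    then have "card S \<le> card (set (cols M))" by (simp add: card_mono maximal_def)
    also have "\<dots> < length (cols M)"
      using nd card_distinct card_length le_neq_implies_less by blast
    finally show False
      using rank_card_indpt[OF M S] rank M by simp
  qed
  show ?thesis
    using full_rank_lin_indpt[OF M rank dist] lin_depI[OF M v(1) _ v(2) dist] by blast
qed

section \<open>The block matrices and the covariance\<close>

lemma block_B_mult_component:
  fixes \<beta> :: "'n::finite \<Rightarrow> nat \<times> nat"
  assumes \<beta>: "block_structure r m \<beta>" and k: "fst (\<beta> i) = k" "Suc k \<le> r"
  shows "(block_B \<beta> Bs *v w) $ i
    = (\<Sum>q<m (Suc k). Bs (Suc k) $$ (snd (\<beta> i), q) * w $ (inv_into UNIV \<beta> (Suc k, q)))"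
proof -
  have bij: "bij_betw \<beta> UNIV (SIGMA k:{..r}. {..<m k})"
    using \<beta> by (simp add: block_structure_def)
  have inj: "inj \<beta>" using bij by (simp add: bij_betw_def)
  have rng: "range \<beta> = (SIGMA k:{..r}. {..<m k})" using bij by (simp add: bij_betw_def)
  have inv: "\<beta> (inv_into UNIV \<beta> (Suc k, q)) = (Suc k, q)" if "q < m (Suc k)" for q
    using that k rng by (intro f_inv_into_f) auto
  have "(block_B \<beta> Bs *v w) $ i
      = (\<Sum>j\<in>UNIV. if fst (\<beta> j) = Suc k then Bs (Suc k) $$ (snd (\<beta> i), snd (\<beta> j)) * w $ j else 0)"
    unfolding matrix_vector_mult_def block_B_def using k by (auto intro!: sum.cong)
  also have "\<dots> = (\<Sum>j | fst (\<beta> j) = Suc k. Bs (Suc k) $$ (snd (\<beta> i), snd (\<beta> j)) * w $ j)"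
    by (simp add: sum.If_cases)
  also have "\<dots> = (\<Sum>q<m (Suc k). Bs (Suc k) $$ (snd (\<beta> i), q) * w $ (inv_into UNIV \<beta> (Suc k, q)))"
  proof (rule sum.reindex_bij_witness[where i="\<lambda>q. inv_into UNIV \<beta> (Suc k, q)" and j="\<lambda>j. snd (\<beta> j)"])
    fix j assume j: "j \<in> {j. fst (\<beta> j) = Suc k}"
    then have b: "\<beta> j = (Suc k, snd (\<beta> j))" by (auto simp: prod_eq_iff)
    show i1: "inv_into UNIV \<beta> (Suc k, snd (\<beta> j)) = j" using inv_f_f[OF inj, of j] b by simp
    have "\<beta> j \<in> (SIGMA k:{..r}. {..<m k})" using rng by auto
    then show "snd (\<beta> j) \<in> {..<m (Suc k)}" using b by (metis lessThan_iff mem_Sigma_iff)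
    show "Bs (Suc k) $$ (snd (\<beta> i), snd (\<beta> j)) * w $ inv_into UNIV \<beta> (Suc k, snd (\<beta> j))
      = Bs (Suc k) $$ (snd (\<beta> i), snd (\<beta> j)) * w $ j" by (simp add: i1)
  qed (auto simp: inv)
  finally show ?thesis .
qed

lemma block_A_quadratic_form:
  fixes \<beta> :: "'n::finite \<Rightarrow> nat \<times> nat"
  assumes \<beta>: "block_structure r m \<beta>" and A0: "A0 \<in> carrier_mat (m 0) (m 0)"
  defines "u \<equiv> \<lambda>w. Matrix.vec (m 0) (\<lambda>p. w $ (inv_into UNIV \<beta> (0, p)))"
  shows "w \<bullet> (block_A \<beta> A0 *v w) = scalar_prod (u w) (A0 *\<^sub>v u w)"
proof -
  have bij: "bij_betw \<beta> UNIV (SIGMA k:{..r}. {..<m k})"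
    using \<beta> by (simp add: block_structure_def)
  have inj: "inj \<beta>" using bij by (simp add: bij_betw_def)
  have rng: "range \<beta> = (SIGMA k:{..r}. {..<m k})" using bij by (simp add: bij_betw_def)
  have inv: "\<beta> (inv_into UNIV \<beta> (0, q)) = (0, q)" if "q < m 0" for q
    using that rng by (intro f_inv_into_f) auto
  have block0: "(\<Sum>j | fst (\<beta> j) = 0. h j) = (\<Sum>q<m 0. h (inv_into UNIV \<beta> (0, q)))" for h :: "'n \<Rightarrow> real"
  proof (rule sum.reindex_bij_witness[where i="\<lambda>q. inv_into UNIV \<beta> (0, q)" and j="\<lambda>j. snd (\<beta> j)"])
    fix j assume j: "j \<in> {j. fst (\<beta> j) = 0}"
    then have b: "\<beta> j = (0, snd (\<beta> j))" by (auto simp: prod_eq_iff)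
    show i1: "inv_into UNIV \<beta> (0, snd (\<beta> j)) = j" using inv_f_f[OF inj, of j] b by simp
    have "\<beta> j \<in> (SIGMA k:{..r}. {..<m k})" using rng by auto
    then show "snd (\<beta> j) \<in> {..<m 0}" using b by (metis lessThan_iff mem_Sigma_iff)
    show "h (inv_into UNIV \<beta> (0, snd (\<beta> j))) = h j" by (simp add: i1)
  qed (auto simp: inv)
  have "w \<bullet> (block_A \<beta> A0 *v w)
      = (\<Sum>i\<in>UNIV. if fst (\<beta> i) = 0 then w $ i * (\<Sum>j\<in>UNIV. if fst (\<beta> j) = 0 then A0 $$ (snd (\<beta> i), snd (\<beta> j)) * w $ j else 0) else 0)"
    unfolding inner_vec_def matrix_vector_mult_def block_A_def by (auto intro!: sum.cong)
  also have "\<dots> = (\<Sum>p<m 0. w $ inv_into UNIV \<beta> (0, p) * (\<Sum>q<m 0. A0 $$ (p, q) * w $ inv_into UNIV \<beta> (0, q)))"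
    by (simp add: sum.If_cases block0 inv)
  also have "\<dots> = scalar_prod (u w) (A0 *\<^sub>v u w)"
    using A0 unfolding scalar_prod_def u_def
    by (auto simp: scalar_prod_def atLeast0LessThan intro!: sum.cong)
  finally show ?thesis .
qed

lemma block_A_symmetric:
  fixes \<beta> :: "'n::finite \<Rightarrow> nat \<times> nat"
  assumes \<beta>: "block_structure r m \<beta>" and A0: "sym_pos_def_mat (m 0) A0"
  shows "transpose (block_A \<beta> A0) = block_A \<beta> A0"
proof -
  have rng: "range \<beta> = (SIGMA k:{..r}. {..<m k})"
    using \<beta> by (simp add: block_structure_def bij_betw_def)
  have "A0 $$ (p, q) = A0 $$ (q, p)" if "p < m 0" "q < m 0" for p q
    using A0 that unfolding sym_pos_def_mat_def by (metis carrier_matD index_transpose_mat(1))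
  moreover have "snd (\<beta> i) < m 0" if "fst (\<beta> i) = 0" for i
  proof -
    have "\<beta> i \<in> (SIGMA k:{..r}. {..<m k})" using rng by auto
    then show ?thesis using that by (auto simp: mem_Sigma_iff split_beta)
  qed
  ultimately show ?thesis by (auto simp: block_A_def transpose_def vec_eq_iff)
qed

lemma block_A_nonneg:
  fixes \<beta> :: "'n::finite \<Rightarrow> nat \<times> nat"
  assumes \<beta>: "block_structure r m \<beta>" and A0: "sym_pos_def_mat (m 0) A0"
  shows "0 \<le> w \<bullet> (block_A \<beta> A0 *v w)"
    and "w \<bullet> (block_A \<beta> A0 *v w) = 0 \<Longrightarrow> fst (\<beta> i) = 0 \<Longrightarrow> w $ i = 0"
proof -
  let ?u = "Matrix.vec (m 0) (\<lambda>p. w $ (inv_into UNIV \<beta> (0, p)))"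
  have inj: "inj \<beta>" and rng: "range \<beta> = (SIGMA k:{..r}. {..<m k})"
    using \<beta> by (simp_all add: block_structure_def bij_betw_def)
  have A0c: "A0 \<in> carrier_mat (m 0) (m 0)"
    and pos: "\<And>v. v \<in> carrier_vec (m 0) \<Longrightarrow> v \<noteq> 0\<^sub>v (m 0) \<Longrightarrow> scalar_prod v (A0 *\<^sub>v v) > 0"
    using A0 by (auto simp: sym_pos_def_mat_def)
  have q: "w \<bullet> (block_A \<beta> A0 *v w) = scalar_prod ?u (A0 *\<^sub>v ?u)"
    using block_A_quadratic_form[OF \<beta> A0c] .
  have u0: "scalar_prod (0\<^sub>v (m 0)) (A0 *\<^sub>v 0\<^sub>v (m 0)) = 0"
    using A0c by (auto simp: scalar_prod_def)
  show "0 \<le> w \<bullet> (block_A \<beta> A0 *v w)"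
    unfolding q using pos[of ?u] u0 by (cases "?u = 0\<^sub>v (m 0)") (auto simp: less_imp_le)
  assume "w \<bullet> (block_A \<beta> A0 *v w) = 0" and i: "fst (\<beta> i) = 0"
  then have "?u = 0\<^sub>v (m 0)" using pos[of ?u] unfolding q by force
  moreover have b: "\<beta> i = (0, snd (\<beta> i))" using i by (auto simp: prod_eq_iff)
  moreover have "\<beta> i \<in> (SIGMA k:{..r}. {..<m k})" using rng by auto
  then have "snd (\<beta> i) < m 0" using b by (metis lessThan_iff mem_Sigma_iff)
  ultimately have "w $ (inv_into UNIV \<beta> (0, snd (\<beta> i))) = 0" by (metis index_vec index_zero_vec(1))
  then show "w $ i = 0" using inv_f_f[OF inj, of i] b by simp
qed

text \<open>
The observability form of the Kalman rank condition. \<open>B\<close> maps block \<open>k + 1\<close> to block \<open>k\<close> through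
the injective matrix \<open>Bs (k + 1)\<close>. Hence if block \<open>k\<close> of every vector \<open>w\<close> as in the assumption
vanishes, then so does block \<open>k\<close> of \<open>B w\<close>, which satisfies the same assumption, and with it
block \<open>k + 1\<close> of \<open>w\<close>.
\<close>
lemma block_B_observable:
  fixes \<beta> :: "'n::finite \<Rightarrow> nat \<times> nat"
  assumes \<beta>: "block_structure r m \<beta>"
    and dim: "\<And>k. k \<in> {1..r} \<Longrightarrow> Bs k \<in> carrier_mat (m (k - 1)) (m k)"
    and rank: "\<And>k. k \<in> {1..r} \<Longrightarrow> vec_space.rank (m (k - 1)) (Bs k) = m k"
    and obs: "\<And>k i. fst (\<beta> i) = 0 \<Longrightarrow> (mat_power (block_B \<beta> Bs) k *v w) $ i = 0"
  shows "w = 0"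
proof -
  let ?B = "block_B \<beta> Bs"
  have inj: "inj \<beta>" and rng: "range \<beta> = (SIGMA k:{..r}. {..<m k})"
    using \<beta> by (simp_all add: block_structure_def bij_betw_def)
  have dom: "\<beta> i \<in> (SIGMA k:{..r}. {..<m k})" for i using rng by auto
  have step: "w $ i = 0" if Bw: "\<And>j. fst (\<beta> j) = k \<Longrightarrow> (?B *v w) $ j = 0" and i: "fst (\<beta> i) = Suc k" for w k i
  proof -
    have b: "\<beta> i = (Suc k, snd (\<beta> i))" using i by (auto simp: prod_eq_iff)
    have kr: "Suc k \<le> r" and si: "snd (\<beta> i) < m (Suc k)"
      using dom[of i] b by (metis atMost_iff mem_Sigma_iff, metis lessThan_iff mem_Sigma_iff)
    let ?v = "Matrix.vec (m (Suc k)) (\<lambda>q. w $ (inv_into UNIV \<beta> (Suc k, q)))"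
    have M: "Bs (Suc k) \<in> carrier_mat (m k) (m (Suc k))" "vec_space.rank (m k) (Bs (Suc k)) = m (Suc k)"
      using dim[of "Suc k"] rank[of "Suc k"] kr by auto
    have "Bs (Suc k) *\<^sub>v ?v = 0\<^sub>v (m k)"
    proof (rule eq_vecI)
      fix p assume p: "p < dim_vec (0\<^sub>v (m k))"
      let ?j = "inv_into UNIV \<beta> (k, p)"
      have j: "\<beta> ?j = (k, p)" using p kr rng by (intro f_inv_into_f) auto
      have "(?B *v w) $ ?j = 0" using Bw[of ?j] j by simp
      then have "(\<Sum>q<m (Suc k). Bs (Suc k) $$ (p, q) * w $ (inv_into UNIV \<beta> (Suc k, q))) = 0"
        using block_B_mult_component[OF \<beta>, of ?j k Bs w] j kr by simp
      then show "vec_index (Bs (Suc k) *\<^sub>v ?v) p = vec_index (0\<^sub>v (m k)) p"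
        using p M(1) by (auto simp: scalar_prod_def atLeast0LessThan)
    qed (use M in auto)
    then have "?v = 0\<^sub>v (m (Suc k))"
      using full_column_rank_kernel[OF M] by simp
    then have "w $ (inv_into UNIV \<beta> (Suc k, snd (\<beta> i))) = 0" using si by (metis index_vec index_zero_vec(1))
    then show ?thesis using inv_f_f[OF inj, of i] b by simp
  qed
  have "w $ i = 0" if "\<And>n j. fst (\<beta> j) = 0 \<Longrightarrow> (mat_power ?B n *v w) $ j = 0" and "fst (\<beta> i) = k" for w k i
    using that
  proof (induction k arbitrary: w i)
    case 0
    from 0(1)[of i 0] 0(2) show ?case by simp
  next
    case (Suc k)
    have "(?B *v w) $ j = 0" if "fst (\<beta> j) = k" for j
    proof (rule Suc.IH[OF _ that])
      fix n j assume "fst (\<beta> j) = 0"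
      from Suc.prems(1)[OF this, of "Suc n"] show "(mat_power ?B n *v (?B *v w)) $ j = 0"
        by (simp add: matrix_vector_mul_assoc mat_power_commute)
    qed
    then show ?case using step Suc.prems(2) by blast
  qed
  then show ?thesis using obs by (simp add: vec_eq_iff)
qed

lemma block_B_power_component:
  fixes \<beta> :: "'n::finite \<Rightarrow> nat \<times> nat"
  assumes "mat_power (block_B \<beta> Bs) k $ i $ j \<noteq> 0"
  shows "fst (\<beta> j) = fst (\<beta> i) + k \<and> (k = 0 \<longrightarrow> i = j)"
  using assms
proof (induction k arbitrary: i)
  case 0
  then show ?case by (auto simp: mat_def split: if_splits)
next
  case (Suc k)
  then have "(\<Sum>l\<in>UNIV. block_B \<beta> Bs $ i $ l * mat_power (block_B \<beta> Bs) k $ l $ j) \<noteq> 0"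
  proof -
    have "(X ** Y) $ i $ j = (\<Sum>l\<in>UNIV. X $ i $ l * Y $ l $ j)" for X Y :: "real^'n^'n"
      by (simp add: matrix_matrix_mult_def)
    then show ?thesis using Suc.prems by simp
  qed
  then obtain l where l: "block_B \<beta> Bs $ i $ l * mat_power (block_B \<beta> Bs) k $ l $ j \<noteq> 0"
    by (rule sum.not_neutral_contains_not_neutral)
  then have "block_B \<beta> Bs $ i $ l \<noteq> 0" by simp
  then have "fst (\<beta> l) = Suc (fst (\<beta> i))"
    by (simp add: block_B_def split: if_splits)
  moreover have "fst (\<beta> j) = fst (\<beta> l) + k"
    using Suc.IH[of l] l by force
  ultimately show ?case by simp
qed

lemma block_B_nilpotent:
  fixes \<beta> :: "'n::finite \<Rightarrow> nat \<times> nat"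
  assumes \<beta>: "block_structure r m \<beta>"
  shows "mat_power (block_B \<beta> Bs) (Suc r) = 0"
proof -
  have le: "fst (\<beta> j) \<le> r" for j
  proof -
    have "\<beta> j \<in> (SIGMA k:{..r}. {..<m k})"
      using \<beta> by (auto simp: block_structure_def bij_betw_def)
    then show ?thesis by auto
  qed
  have "mat_power (block_B \<beta> Bs) (Suc r) $ i $ j = 0" for i j
  proof (rule ccontr)
    assume "mat_power (block_B \<beta> Bs) (Suc r) $ i $ j \<noteq> 0"
    from block_B_power_component[OF this] le[of j] show False by simp
  qed
  then show ?thesis by (simp add: vec_eq_iff)
qed

text \<open>
\<open>drift_E B t\<close> is the transpose of the exponential of a matrix that strictly lowers the block number,
and such an exponential is unitriangular.
\<close>
lemma drift_E_det:
  fixes \<beta> :: "'n::finite \<Rightarrow> nat \<times> nat"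
  assumes \<beta>: "block_structure r m \<beta>"
  shows "det (drift_E (block_B \<beta> Bs) t) = 1"
proof -
  let ?B = "block_B \<beta> Bs"
  note nil = block_B_nilpotent[OF \<beta>, of Bs]
  have "drift_E ?B t = transpose (matrix_exp ((- t) *\<^sub>R ?B))"
    unfolding drift_E_def transpose_matrix_exp[OF nil] ..
  moreover have "det (matrix_exp ((- t) *\<^sub>R ?B)) = 1"
  \<comment> \<open>The matrix is upper triangular in the block number, hence the reversed level function.\<close>
  proof (rule det_unitriangular[where l="\<lambda>i. r - fst (\<beta> i)"])
    have comp: "matrix_exp ((- t) *\<^sub>R ?B) $ i $ j = (\<Sum>k\<le>r. ((- t) ^ k / fact k) * mat_power ?B k $ i $ j)" for i j
      by (simp only: matrix_exp_nilpotent[OF nil] sum_component vector_scaleR_component real_scaleR_def)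
    show "matrix_exp ((- t) *\<^sub>R ?B) $ i $ i = 1" for i
    proof -
      have summand: "((- t) ^ k / fact k) * mat_power ?B k $ i $ i = (if k = 0 then 1 else 0)" for k
      proof (cases "k = 0")
        case True
        then show ?thesis by (simp add: mat_def)
      next
        case False
        then have "mat_power ?B k $ i $ i = 0"
          using block_B_power_component[of k \<beta> Bs i i] by linarith
        then show ?thesis using False by simp
      qed
      show ?thesis unfolding comp summand by simp
    qed
    fix i j assume ne: "i \<noteq> j" and nz: "matrix_exp ((- t) *\<^sub>R ?B) $ i $ j \<noteq> 0"
    from nz[unfolded comp] obtain k where "((- t) ^ k / fact k) * mat_power ?B k $ i $ j \<noteq> 0"
      by (rule sum.not_neutral_contains_not_neutral)
    then have "mat_power ?B k $ i $ j \<noteq> 0" using mult_not_zero by blast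
    from block_B_power_component[OF this]
    have k: "fst (\<beta> j) = fst (\<beta> i) + k" "k = 0 \<longrightarrow> i = j" by simp_all
    have "\<beta> j \<in> (SIGMA k:{..r}. {..<m k})"
      using \<beta> by (auto simp: block_structure_def bij_betw_def)
    then have "fst (\<beta> j) \<le> r" by auto
    moreover have "k \<noteq> 0" using k(2) ne by blast
    ultimately show "r - fst (\<beta> j) < r - fst (\<beta> i)" using k(1) by linarith
  qed
  ultimately show ?thesis by simp
qed

lemma continuous_on_drift_E:
  assumes "mat_power (transpose B) (Suc r) = 0"
  shows "continuous_on S (drift_E B)"
proof -
  have 1: "continuous_on UNIV (\<lambda>s. matrix_exp (s *\<^sub>R transpose B))"
    using has_vector_derivative_continuous[OF has_vector_derivative_matrix_exp[OF assms]]
    by (simp add: continuous_on_eq_continuous_within)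
  have 2: "continuous_on S (\<lambda>t::real. - t)"
    by (intro continuous_intros)
  show ?thesis
    unfolding drift_E_def[abs_def] using continuous_on_compose2[OF 1 2] by simp
qed

lemma continuous_on_cov_integrand:
  assumes "mat_power (transpose B) (Suc r) = 0"
  shows "continuous_on S (\<lambda>s. drift_E B s ** A ** transpose (drift_E B s))"
  by (intro bounded_bilinear.continuous_on[OF bounded_bilinear_matrix_mult]
      continuous_on_drift_E[OF assms] continuous_on_const
      bounded_linear.continuous_on[OF bounded_linear_transpose])

text \<open>
The matrix of the Poincare inequality is the covariance matrix transported by \<open>drift_E B (- t)\<close>,
because \<open>drift_E B (- (t - s)) = drift_E B (- t) ** drift_E B s\<close>.
\<close>
lemma cov_C_congruence:
  fixes A B :: "real^'n^'n"
  assumes nil: "mat_power (transpose B) (Suc r) = 0"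
  shows "integral {0..t} (\<lambda>s. drift_E B (- (t - s)) ** A ** transpose (drift_E B (- (t - s))))
    = drift_E B (- t) ** cov_C A B t ** transpose (drift_E B (- t))"
proof -
  let ?M = "drift_E B (- t)"
  have add: "drift_E B (- (t - s)) = ?M ** drift_E B s" for s
  proof -
    have "- (- (t - s)) = t + - s" "- (- t) = t" by simp_all
    then show ?thesis unfolding drift_E_def by (simp only: matrix_exp_add[OF nil])
  qed
  have bl: "bounded_linear (\<lambda>X. ?M ** X ** transpose ?M)"
    unfolding linear_conv_bounded_linear[symmetric]
    by (rule linearI) (simp_all add: matrix_mult_simps)
  have "drift_E B (- (t - s)) ** A ** transpose (drift_E B (- (t - s)))
      = ?M ** (drift_E B s ** A ** transpose (drift_E B s)) ** transpose ?M" for s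
    by (simp only: add matrix_transpose_mul matrix_mul_assoc)
  then have "integral {0..t} (\<lambda>s. drift_E B (- (t - s)) ** A ** transpose (drift_E B (- (t - s))))
    = integral {0..t} ((\<lambda>X. ?M ** X ** transpose ?M) \<circ> (\<lambda>s. drift_E B s ** A ** transpose (drift_E B s)))"
    by (simp add: o_def)
  also have "\<dots> = ?M ** cov_C A B t ** transpose ?M"
    unfolding cov_C_def
    by (rule integral_linear[OF _ bl])
       (intro integrable_continuous_real continuous_on_cov_integrand[OF nil])
  finally show ?thesis .
qed

lemma cov_C_symmetric:
  assumes nil: "mat_power (transpose B) (Suc r) = 0" and A: "transpose A = A"
  shows "transpose (cov_C A B t) = cov_C A B t"
proof -
  have "transpose (cov_C A B t) = integral {0..t} (transpose \<circ> (\<lambda>s. drift_E B s ** A ** transpose (drift_E B s)))"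
    unfolding cov_C_def
    by (rule integral_linear[OF _ bounded_linear_transpose, symmetric])
       (intro integrable_continuous_real continuous_on_cov_integrand[OF nil])
  also have "\<dots> = cov_C A B t"
    unfolding cov_C_def o_def by (simp add: matrix_transpose_mul matrix_mul_assoc A)
  finally show ?thesis .
qed

lemma cov_C_quadratic_form:
  fixes A B :: "real^'n^'n"
  assumes nil: "mat_power (transpose B) (Suc r) = 0" and "0 \<le> t"
  shows "((\<lambda>s. (transpose (drift_E B s) *v v) \<bullet> (A *v (transpose (drift_E B s) *v v)))
    has_integral v \<bullet> (cov_C A B t *v v)) {0..t}"
proof -
  have bl: "bounded_linear (\<lambda>X::real^'n^'n. v \<bullet> (X *v v))"
    unfolding linear_conv_bounded_linear[symmetric]
    by (rule linearI) (auto simp: matrix_vector_mult_add_rdistrib inner_add_right scaleR_matrix_vector_assoc[symmetric])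
  have "(\<lambda>s. drift_E B s ** A ** transpose (drift_E B s)) integrable_on {0..t}"
    by (intro integrable_continuous_real continuous_on_cov_integrand[OF nil])
  then have "((\<lambda>s. drift_E B s ** A ** transpose (drift_E B s)) has_integral cov_C A B t) {0..t}"
    unfolding cov_C_def by (rule integrable_integral)
  from has_integral_linear[OF this bl]
  have "((\<lambda>s. v \<bullet> ((drift_E B s ** A ** transpose (drift_E B s)) *v v)) has_integral v \<bullet> (cov_C A B t *v v)) {0..t}"
    by (simp add: o_def)
  moreover have "v \<bullet> ((drift_E B s ** A ** transpose (drift_E B s)) *v v)
      = (transpose (drift_E B s) *v v) \<bullet> (A *v (transpose (drift_E B s) *v v))" for s
    by (simp only: matrix_vector_mul_assoc[symmetric] inner_transpose)
  ultimately show ?thesis by simp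
qed

text \<open>
If the quadratic form of the covariance vanishes at \<open>v\<close>, its continuous nonnegative integrand vanishes,
that is, the coordinates in \<open>Z\<close> of \<open>h s = exp (- s B) v\<close> are zero on the interval. Since
differentiating \<open>h\<close> multiplies it by \<open>- B\<close>, the same coordinates of \<open>B\<^sup>k (h s)\<close> are zero for all \<open>k\<close>. By
observability \<open>h s = 0\<close>, and so \<open>v = 0\<close>.
\<close>
lemma cov_C_positive:
  fixes A B :: "real^'n^'n" and Z :: "'n set"
  assumes nilB: "mat_power B (Suc r) = 0"
    and A_nonneg: "\<And>w. 0 \<le> w \<bullet> (A *v w)"
    and A_zero: "\<And>w i. w \<bullet> (A *v w) = 0 \<Longrightarrow> i \<in> Z \<Longrightarrow> w $ i = 0"
    and obs: "\<And>w. (\<And>k i. i \<in> Z \<Longrightarrow> (mat_power B k *v w) $ i = 0) \<Longrightarrow> w = 0"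
    and t: "0 < t" and v: "v \<noteq> 0"
  shows "0 < v \<bullet> (cov_C A B t *v v)"
proof (rule ccontr)
  assume neg: "\<not> 0 < v \<bullet> (cov_C A B t *v v)"
  have nil: "mat_power (transpose B) (Suc r) = 0"
    by (rule mat_power_transpose_eq_0[OF nilB])
  define h where "h = (\<lambda>s. matrix_exp ((- s) *\<^sub>R B) *v v)"
  have Et: "transpose (drift_E B s) = matrix_exp ((- s) *\<^sub>R B)" for s
    unfolding drift_E_def transpose_matrix_exp[OF nil] by simp
  have int: "((\<lambda>s. h s \<bullet> (A *v h s)) has_integral v \<bullet> (cov_C A B t *v v)) {0..t}"
    using cov_C_quadratic_form[OF nil, of t v A] t unfolding Et h_def by simp
  have bl: "bounded_linear (\<lambda>X::real^'n^'n. (M ** X) *v v)" for M :: "real^'n^'n"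
    unfolding linear_conv_bounded_linear[symmetric]
    by (rule linearI) (auto simp: matrix_mult_simps matrix_vector_mult_add_rdistrib scaleR_matrix_vector_assoc[symmetric])
  have deriv: "((\<lambda>s. mat_power B k *v h s) has_vector_derivative - (mat_power B (Suc k) *v h s)) (at s)" for k s
  proof -
    have "((\<lambda>s. - s) has_vector_derivative - 1) (at s)"
      unfolding has_real_derivative_iff_has_vector_derivative[symmetric]
      by (auto intro!: derivative_eq_intros)
    from vector_diff_chain_at[OF this has_vector_derivative_matrix_exp[OF nilB]]
    have "((\<lambda>s. matrix_exp ((- s) *\<^sub>R B)) has_vector_derivative - (B ** matrix_exp ((- s) *\<^sub>R B))) (at s)"
      by (simp add: o_def)
    from bounded_linear.has_vector_derivative[OF bl this, of "mat_power B k"]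
    have "((\<lambda>s. mat_power B k *v h s) has_vector_derivative (mat_power B k ** - (B ** matrix_exp ((- s) *\<^sub>R B))) *v v) (at s)"
      by (simp add: h_def matrix_vector_mul_assoc)
    moreover have "(mat_power B k ** - (B ** matrix_exp ((- s) *\<^sub>R B))) *v v = - (mat_power B (Suc k) *v h s)"
    proof -
      have "(- X) *v v = - (X *v v)" for X :: "real^'n^'n"
        using scaleR_matrix_vector_assoc[of "- 1" X v] by simp
      then show ?thesis
        by (simp add: h_def matrix_mult_simps matrix_mul_assoc matrix_vector_mul_assoc mat_power_commute)
    qed
    ultimately show ?thesis by simp
  qed
  have cont_h: "continuous_on S h" for S
  proof -
    have "continuous_on UNIV (\<lambda>s. mat_power B 0 *v h s)"
      using has_vector_derivative_continuous[OF deriv[of 0]]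
      by (simp add: continuous_on_eq_continuous_within)
    then show ?thesis by (auto intro: continuous_on_subset)
  qed
  have cont: "continuous_on {0..t} (\<lambda>s. h s \<bullet> (A *v h s))"
    by (intro continuous_on_inner cont_h
        bounded_linear.continuous_on[OF matrix_vector_mul_bounded_linear])
  have "v \<bullet> (cov_C A B t *v v) = 0"
    using has_integral_nonneg[OF int] A_nonneg neg by force
  then have zero: "h s \<bullet> (A *v h s) = 0" if "s \<in> {0..t}" for s
    using integral_eq_0_iff[OF cont t] A_nonneg int that by (metis integral_unique)
  have vanish: "(mat_power B k *v h s) $ i = 0" if "i \<in> Z" "s \<in> {0<..<t}" for k s i
    using that(2)
  proof (induction k arbitrary: s)
    case 0
    then show ?case using A_zero[OF zero[of s] that(1)] by simp
  next
    case (Suc k)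
    have "((\<lambda>s. (mat_power B k *v h s) $ i) has_vector_derivative (- (mat_power B (Suc k) *v h s)) $ i) (at s)"
      using bounded_linear.has_vector_derivative[OF bounded_linear_vec_nth deriv] .
    moreover have "((\<lambda>s. (mat_power B k *v h s) $ i) has_vector_derivative 0) (at s)"
    proof (rule has_vector_derivative_transform_within_open[where S="{0<..<t}" and f="\<lambda>_. 0"])
      show "0 = (mat_power B k *v h x) $ i" if "x \<in> {0<..<t}" for x
        using Suc.IH[OF that] by simp
    qed (use Suc.prems in auto)
    ultimately have "(- (mat_power B (Suc k) *v h s)) $ i = 0"
      by (rule vector_derivative_unique_at)
    then show ?case by simp
  qed
  have "h (t / 2) = 0"
    using t by (intro obs vanish) auto
  then have "matrix_exp ((t / 2) *\<^sub>R B) *v h (t / 2) = 0" by simp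
  then have "v = 0"
    using matrix_exp_inverse[OF nilB, of "t / 2"] by (simp add: h_def matrix_vector_mul_assoc)
  with v show False by simp
qed

section \<open>The semigroup as a Gaussian average\<close>

text \<open>
Probabilistically, the semigroup at \<open>x\<close> averages over a Gaussian vector with mean \<open>M x\<close> and
covariance \<open>M C M\<^sup>T\<close>, where \<open>M\<close> is the inverse of \<open>drift_E B t\<close>. The substitution \<open>y = M x + M L w\<close>
turns the argument \<open>x - E y\<close> of the kernel into \<open>- L w\<close>, and \<open>C = L L\<^sup>T\<close> turns the kernel
into the standard Gaussian density of \<open>w\<close>.
\<close>
lemma semigroup_P_eq_gauss:
  fixes A B L M :: "real^'n^'n"
  assumes C: "cov_C A B t = L ** transpose L" and L: "det L \<noteq> 0"
    and M: "drift_E B t ** M = mat 1" "det M = 1"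
    and t: "t \<noteq> 0" and [measurable]: "f \<in> borel_measurable borel"
  shows "semigroup_P A B t f x = (\<integral>w. f (M *v x + (M ** L) *v w) \<partial>gauss)"
proof -
  let ?C = "cov_C A B t" and ?E = "drift_E B t"
  let ?H = "\<lambda>y. heat_kernel A B (x - ?E *v y) t * f y"
  have detC: "det ?C = (det L)\<^sup>2" by (simp add: C det_mul power2_eq_square)
  have invC: "?C ** matrix_inv ?C = mat 1"
  proof -
    have "invertible ?C" using L detC by (simp add: invertible_det_nz)
    then show ?thesis unfolding invertible_def matrix_inv_def by (rule someI2_ex) simp
  qed
  have kernel: "heat_kernel A B (x - ?E *v (M *v x + (M ** L) *v w)) t * \<bar>det L\<bar> = gauss_density w" for w
  proof -
    have "?E *v (M *v x + (M ** L) *v w) = x + L *v w"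
      by (simp only: matrix_vector_right_distrib matrix_vector_mul_assoc matrix_mul_assoc M(1))
         (simp only: matrix_vector_mul_lid matrix_mul_lid)
    then have z: "x - ?E *v (M *v x + (M ** L) *v w) = L *v (- w)"
      by (simp add: linear_neg[OF matrix_vector_mul_linear])
    define u where "u = matrix_inv ?C *v (L *v (- w))"
    have "L *v (transpose L *v u) = ?C *v u"
      by (simp only: C matrix_vector_mul_assoc)
    also have "\<dots> = (?C ** matrix_inv ?C) *v (L *v (- w))"
      by (simp only: u_def matrix_vector_mul_assoc matrix_mul_assoc)
    also have "\<dots> = L *v (- w)" by (simp only: invC matrix_vector_mul_lid)
    finally have "L *v (transpose L *v u) = L *v (- w)" .
    then have "transpose L *v u = - w"
      using L det_nz_iff_inj[of "(*v) L"] by (simp add: inj_eq)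
    then have "u \<bullet> (L *v (- w)) = w \<bullet> w"
      using inner_transpose[of L u "- w"] by simp
    then have "heat_kernel A B (x - ?E *v (M *v x + (M ** L) *v w)) t
        = (2 * pi) powr (- (real CARD('n) / 2)) / \<bar>det L\<bar> * exp (- (norm w)\<^sup>2 / 2)"
      unfolding heat_kernel_def z u_def[symmetric] detC by (simp add: power2_norm_eq_inner)
    then show ?thesis using L by (simp add: gauss_density_def)
  qed
  have detK: "det (M ** L) \<noteq> 0" "\<bar>det (M ** L)\<bar> = \<bar>det L\<bar>" using L M(2) by (simp_all add: det_mul)
  have [measurable]: "(\<lambda>y. N *v y) \<in> borel_measurable borel" for N :: "real^'n^'n"
    by (intro borel_measurable_continuous_onI continuous_intros)
  have H [measurable]: "?H \<in> borel_measurable borel"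
    unfolding heat_kernel_def by measurable
  have "semigroup_P A B t f x = (\<integral>y. ?H y \<partial>lborel)" using t by (simp add: semigroup_P_def)
  also have "\<dots> = (\<integral>y. ?H y \<partial>distr lborel borel ((+) (M *v x)))" by (simp add: lborel_distr_plus)
  also have "\<dots> = (\<integral>y. ?H (M *v x + y) \<partial>lborel)" by (subst integral_distr) auto
  also have "\<dots> = \<bar>det (M ** L)\<bar> * (\<integral>w. ?H (M *v x + (M ** L) *v w) \<partial>lborel)"
    by (rule integral_lborel_linear[OF detK(1)]) measurable
  also have "\<dots> = (\<integral>w. gauss_density w * f (M *v x + (M ** L) *v w) \<partial>lborel)"
  proof -
    have "\<bar>det L\<bar> * ?H (M *v x + (M ** L) *v w) = gauss_density w * f (M *v x + (M ** L) *v w)" for w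
      unfolding kernel[symmetric] by (simp only: ac_simps)
    then show ?thesis unfolding detK(2) integral_mult_right_zero[symmetric] by (simp only:)
  qed
  also have "\<dots> = (\<integral>w. f (M *v x + (M ** L) *v w) \<partial>gauss)"
    by (rule integral_gauss[symmetric]) measurable
  finally show ?thesis .
qed

text \<open>
The Riesz representation, which passes from derivatives to gradients.
\<close>
lemma linear_functional_eq_inner:
  fixes D :: "'a::euclidean_space \<Rightarrow> real"
  assumes "linear D"
  shows "\<exists>g. \<forall>h. D h = h \<bullet> g"
proof (intro exI[of _ "\<Sum>b\<in>Basis. D b *\<^sub>R b"] allI)
  fix h
  have "D h = D (\<Sum>b\<in>Basis. (h \<bullet> b) *\<^sub>R b)" by (simp only: euclidean_representation)
  also have "\<dots> = (\<Sum>b\<in>Basis. (h \<bullet> b) * D b)"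
    by (simp only: linear_sum[OF assms] linear_scale[OF assms] real_scaleR_def)
  finally show "D h = h \<bullet> (\<Sum>b\<in>Basis. D b *\<^sub>R b)"
    by (simp add: inner_sum_right mult.commute)
qed

lemma grad_eqI:
  assumes "GDERIV f x :> g"
  shows "grad f x = g"
  unfolding grad_def
proof (rule the_equality)
  show "GDERIV f x :> g" by (rule assms)
  fix g' assume "GDERIV f x :> g'"
  with assms have "(\<lambda>h. h \<bullet> g') = (\<lambda>h. h \<bullet> g)"
    unfolding gderiv_def by (rule has_derivative_unique[rotated])
  then have "h \<bullet> g' = h \<bullet> g" for h by (rule fun_cong)
  then show "g' = g" using vector_eq_ldot by blast
qed

lemma GDERIV_grad:
  fixes f :: "'a::euclidean_space \<Rightarrow> real"
  assumes "f differentiable (at x)"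
  shows "GDERIV f x :> grad f x"
proof -
  obtain D where D: "(f has_derivative D) (at x)" using assms by (auto simp: differentiable_def)
  obtain g where "\<And>h. D h = h \<bullet> g"
    using linear_functional_eq_inner[OF has_derivative_linear[OF D]] by blast
  then have "D = (\<lambda>h. h \<bullet> g)" by (rule ext)
  with D have g: "GDERIV f x :> g" by (simp only: gderiv_def)
  then show ?thesis by (simp only: grad_eqI[OF g])
qed

lemma lipschitz_imp_norm_grad_le:
  fixes f :: "'a::euclidean_space \<Rightarrow> real"
  assumes L: "L-lipschitz_on UNIV f" and g: "GDERIV f x :> g"
  shows "norm g \<le> L"
proof -
  have "((\<lambda>s. f (x + s *\<^sub>R g)) has_real_derivative (g \<bullet> g)) (at 0)"
    by (rule GDERIV_along_line[OF g])
  then have "((\<lambda>s. (f (x + s *\<^sub>R g) - f x) / s) \<longlongrightarrow> g \<bullet> g) (at 0)"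
    by (simp add: DERIV_def)
  moreover have "(f (x + s *\<^sub>R g) - f x) / s \<le> L * norm g" for s
  proof -
    have "\<bar>f (x + s *\<^sub>R g) - f x\<bar> \<le> L * (\<bar>s\<bar> * norm g)"
      using lipschitz_onD[OF L, of "x + s *\<^sub>R g" x] by (simp add: dist_norm)
    then have "\<bar>f (x + s *\<^sub>R g) - f x\<bar> \<le> (L * norm g) * \<bar>s\<bar>"
      by (simp only: ac_simps)
    then have "\<bar>(f (x + s *\<^sub>R g) - f x) / s\<bar> \<le> L * norm g"
      using lipschitz_on_nonneg[OF L]
      by (cases "s = 0") (simp_all add: abs_divide pos_divide_le_eq)
    then show ?thesis by linarith
  qed
  ultimately have "g \<bullet> g \<le> L * norm g"
    by (intro tendsto_upperbound) auto
  then show ?thesis using lipschitz_on_nonneg[OF L]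
    by (cases "g = 0") (auto simp: dot_square_norm power2_eq_square)
qed

text \<open>
The Poincare inequality for \<open>w \<mapsto> f (a + K w)\<close>, whose gradient is \<open>K\<^sup>T\<close> applied to the gradient of \<open>f\<close>.
\<close>
lemma gauss_affine_poincare:
  fixes K :: "real^'n^'n" and f :: "real^'n \<Rightarrow> real"
  assumes f: "C1_fun f" and lip: "c-lipschitz_on UNIV f" and bd: "\<And>x. \<bar>f x\<bar> \<le> b"
  shows "(\<integral>w. (f (a + K *v w))\<^sup>2 \<partial>gauss) - (\<integral>w. f (a + K *v w) \<partial>gauss)\<^sup>2
    \<le> (\<integral>w. ((K ** transpose K) *v grad f (a + K *v w)) \<bullet> grad f (a + K *v w) \<partial>gauss)"
proof -
  let ?g = "\<lambda>w. transpose K *v grad f (a + K *v w)"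
  have G: "GDERIV f x :> grad f x" for x using f by (intro GDERIV_grad) (auto simp: C1_fun_def)
  have "(\<integral>w. (f (a + K *v w))\<^sup>2 \<partial>gauss) - (\<integral>w. f (a + K *v w) \<partial>gauss)\<^sup>2 \<le> (\<integral>w. ?g w \<bullet> ?g w \<partial>gauss)"
  proof (rule gauss_poincare)
    show "GDERIV (\<lambda>w. f (a + K *v w)) w :> ?g w" for w
    proof -
      have "((\<lambda>w. a + K *v w) has_derivative (\<lambda>h. K *v h)) (at w)"
        by (auto intro!: derivative_eq_intros bounded_linear_imp_has_derivative)
      from has_derivative_compose[OF this G[unfolded gderiv_def]]
      show ?thesis by (simp only: gderiv_def inner_transpose inner_commute[of _ "_ *v _"])
    qed
    have c: "continuous_on UNIV (\<lambda>w. a + K *v w)" by (intro continuous_intros)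
    have g: "continuous_on UNIV (grad f)" using f by (simp add: C1_fun_def)
    have "continuous_on UNIV (\<lambda>w. grad f (a + K *v w))"
      using continuous_on_compose2[OF g c] by simp
    then show "continuous_on UNIV ?g"
      by (rule bounded_linear.continuous_on[OF matrix_vector_mul_bounded_linear])
    show "\<bar>f (a + K *v w)\<bar> \<le> b" for w by (rule bd)
    show "norm (?g w) \<le> onorm ((*v) (transpose K)) * c" for w
      using onorm[OF matrix_vector_mul_bounded_linear, of "transpose K" "grad f (a + K *v w)"]
        mult_left_mono[OF lipschitz_imp_norm_grad_le[OF lip G] onorm_pos_le[OF matrix_vector_mul_bounded_linear]]
      by (rule order_trans)
  qed
  moreover have "?g w \<bullet> ?g w = ((K ** transpose K) *v grad f (a + K *v w)) \<bullet> grad f (a + K *v w)" for w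
    unfolding matrix_vector_mul_assoc[symmetric]
    by (metis inner_commute inner_transpose)
  ultimately show ?thesis by (simp only:)
qed

text \<open>
Moving the base point from \<open>x\<close> to \<open>y\<close> shifts the Gaussian variable by \<open>L\<inverse> (y - x)\<close>, because \<open>(M L) L\<inverse> = M\<close>. Hence
\<open>u\<close> is differentiable at \<open>x\<close> with gradient \<open>(L\<inverse>)\<^sup>T G\<close>, where \<open>G\<close> is the expectation of
\<open>f (M x + M L w) w\<close>, and the form \<open>L L\<^sup>T\<close> of this gradient is \<open>G \<bullet> G\<close>.
\<close>
lemma gauss_affine_reverse_poincare:
  fixes L M :: "real^'n^'n" and f u :: "real^'n \<Rightarrow> real"
  assumes [measurable]: "f \<in> borel_measurable borel" and bd: "\<And>x. \<bar>f x\<bar> \<le> b"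
    and L: "det L \<noteq> 0"
    and u: "\<And>x. u x = (\<integral>w. f (M *v x + (M ** L) *v w) \<partial>gauss)"
  shows "u differentiable (at x)"
    and "((L ** transpose L) *v grad u x) \<bullet> grad u x
      \<le> (\<integral>w. (f (M *v x + (M ** L) *v w))\<^sup>2 \<partial>gauss) - (u x)\<^sup>2"
proof -
  let ?K = "M ** L"
  define F where "F = (\<lambda>w. f (M *v x + ?K *v w))"
  have [measurable]: "(\<lambda>w. M *v x + ?K *v w) \<in> borel_measurable borel"
    by (intro borel_measurable_continuous_onI continuous_intros)
  have F_meas: "F \<in> borel_measurable borel" unfolding F_def by measurable
  have F_bd: "\<bar>F w\<bar> \<le> b" for w by (simp add: F_def bd)
  obtain R where R: "L ** R = mat 1" "R ** L = mat 1"
    using L by (auto simp: invertible_det_nz[symmetric] invertible_def)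
  have D0: "((\<lambda>h. \<integral>w. F (w + h) \<partial>gauss) has_derivative (\<lambda>h. \<integral>w. F w * (w \<bullet> h) \<partial>gauss)) (at 0)"
    by (rule gauss_shift_has_derivative[OF F_meas F_bd])
  obtain G where G: "\<And>h. (\<integral>w. F w * (w \<bullet> h) \<partial>gauss) = h \<bullet> G"
    using linear_functional_eq_inner[OF has_derivative_linear[OF D0]] by blast
  have u_eq: "u y = (\<integral>w. F (w + R *v (y - x)) \<partial>gauss)" for y
  proof -
    have "?K ** R = M" by (simp only: matrix_mul_assoc[symmetric] R matrix_mul_rid)
    then have "?K *v (R *v (y - x)) = M *v y - M *v x"
      by (simp only: matrix_vector_mul_assoc matrix_vector_mult_diff_distrib)
    then have "M *v x + ?K *v (w + R *v (y - x)) = M *v y + ?K *v w" for w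
      by (simp only: matrix_vector_right_distrib) simp
    then show ?thesis by (simp only: u F_def)
  qed
  have "((\<lambda>y. R *v (y - x)) has_derivative (\<lambda>h. R *v h)) (at x)"
  proof -
    have "((\<lambda>y. y - x) has_derivative (\<lambda>h. h)) (at x)" by (auto intro!: derivative_eq_intros)
    from bounded_linear.has_derivative[OF matrix_vector_mul_bounded_linear this] show ?thesis .
  qed
  from has_derivative_compose[OF this, of "\<lambda>h. \<integral>w. F (w + h) \<partial>gauss" "\<lambda>h. h \<bullet> G"] D0
  have Du: "(u has_derivative (\<lambda>h. (R *v h) \<bullet> G)) (at x)"
    unfolding G by (simp add: u_eq[abs_def])
  then show "u differentiable (at x)" by (auto simp: differentiable_def)
  have "GDERIV u x :> transpose R *v G"
    using Du by (simp only: gderiv_def inner_commute[of _ "transpose R *v G"] inner_transpose)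
      (simp only: inner_commute)
  then have g: "grad u x = transpose R *v G" by (rule grad_eqI)
  have "transpose L *v grad u x = G"
    by (simp only: g matrix_vector_mul_assoc matrix_transpose_mul[symmetric] R)
       (simp only: transpose_mat matrix_vector_mul_lid)
  then have "((L ** transpose L) *v grad u x) \<bullet> grad u x = G \<bullet> G"
    by (simp only: matrix_vector_mul_assoc[symmetric])
       (metis inner_commute inner_transpose)
  also have "\<dots> \<le> (\<integral>w. (F w)\<^sup>2 \<partial>gauss) - (\<integral>w. F w \<partial>gauss)\<^sup>2"
    by (rule gauss_reverse_poincare[OF F_meas F_bd]) (simp only: G inner_commute[of G])
  finally show "((L ** transpose L) *v grad u x) \<bullet> grad u x
      \<le> (\<integral>w. (f (M *v x + (M ** L) *v w))\<^sup>2 \<partial>gauss) - (u x)\<^sup>2"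
    by (simp add: u F_def)
qed

theorem theorem3p1:
  fixes r :: nat and m :: "nat \<Rightarrow> nat"
    and A0 :: "real mat" and Bs :: "nat \<Rightarrow> real mat"
    and \<beta> :: "'n::finite \<Rightarrow> nat \<times> nat"
    and A B :: "real ^ 'n ^ 'n"
  assumes r: "r \<ge> 1"
    and m_dec: "\<And>k. k < r \<Longrightarrow> m (Suc k) \<le> m k"
    and m_pos: "m r \<ge> 1"
    and A0: "sym_pos_def_mat (m 0) A0"
    and Bs_dim: "\<And>k. k \<in> {1..r} \<Longrightarrow> Bs k \<in> carrier_mat (m (k - 1)) (m k)"
    and Bs_rank: "\<And>k. k \<in> {1..r} \<Longrightarrow> vec_space.rank (m (k - 1)) (Bs k) = m k"
    and \<beta>: "block_structure r m \<beta>"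
    and A_def: "A = block_A \<beta> A0"
    and B_def: "B = block_B \<beta> Bs"
  shows
    "(\<forall>f :: real ^ 'n \<Rightarrow> real.
        C1_fun f \<and> (\<exists>L. L-lipschitz_on UNIV f) \<and> bounded (range f) \<longrightarrow>
        (\<forall>t \<ge> 0. \<forall>x.
           semigroup_P A B t (\<lambda>y. (f y)\<^sup>2) x - (semigroup_P A B t f x)\<^sup>2 \<le>
           semigroup_P A B t
             (\<lambda>y. (integral {0..t}
                      (\<lambda>s. drift_E B (- (t - s)) ** A ** transpose (drift_E B (- (t - s))))
                    *v grad f y) \<bullet> grad f y) x))
     \<and>
     (\<forall>t > 0. \<forall>f :: real ^ 'n \<Rightarrow> real.
        f \<in> borel_measurable borel \<and> bounded (range f) \<longrightarrow>
        (\<forall>x. semigroup_P A B t f differentiable (at x) \<and>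
           semigroup_P A B t (\<lambda>y. (f y)\<^sup>2) x - (semigroup_P A B t f x)\<^sup>2 \<ge>
           (cov_C A B t *v grad (semigroup_P A B t f) x) \<bullet> grad (semigroup_P A B t f) x))"
proof -
  have nilB: "mat_power B (Suc r) = 0" unfolding B_def by (rule block_B_nilpotent[OF \<beta>])
  have nil: "mat_power (transpose B) (Suc r) = 0"
    by (rule mat_power_transpose_eq_0[OF nilB])
  have A_sym: "transpose A = A" unfolding A_def by (rule block_A_symmetric[of r m, OF \<beta> A0])
  have C_pos: "0 < v \<bullet> (cov_C A B t *v v)" if "0 < t" "v \<noteq> 0" for t v
  proof (rule cov_C_positive[where Z="{i. fst (\<beta> i) = 0}", OF nilB _ _ _ that])
    show "0 \<le> w \<bullet> (A *v w)" for w
      unfolding A_def by (rule block_A_nonneg(1)[OF \<beta> A0])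
    show "w $ i = 0" if "w \<bullet> (A *v w) = 0" "i \<in> {i. fst (\<beta> i) = 0}" for w i
      using block_A_nonneg(2)[OF \<beta> A0, of w i] that unfolding A_def by simp
    show "w = 0" if "\<And>k i. i \<in> {i. fst (\<beta> i) = 0} \<Longrightarrow> (mat_power B k *v w) $ i = 0" for w
      using block_B_observable[OF \<beta> Bs_dim Bs_rank, of w] that unfolding B_def by simp
  qed
  \<comment> \<open>All representations at time \<open>t\<close> use the same factor \<open>L\<close> for every \<open>f\<close> and \<open>x\<close>.\<close>
  have rep: "\<exists>L :: real^'n^'n. cov_C A B t = L ** transpose L \<and> det L \<noteq> 0 \<and>
      (\<forall>f x. f \<in> borel_measurable borel \<longrightarrow>
        semigroup_P A B t f x = (\<integral>w. f (drift_E B (- t) *v x + (drift_E B (- t) ** L) *v w) \<partial>gauss))"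
    if t: "0 < t" for t
  proof -
    obtain L where L: "cov_C A B t = L ** transpose L" "det L \<noteq> 0"
      using pos_def_factorization[OF cov_C_symmetric[OF nil A_sym] C_pos[OF t]] by blast
    have "drift_E B t ** drift_E B (- t) = mat 1"
      using matrix_exp_inverse[OF nil, of "- t"] by (simp only: drift_E_def)
    moreover have "det (drift_E B (- t)) = 1"
      unfolding B_def by (rule drift_E_det[OF \<beta>])
    ultimately show ?thesis
      using semigroup_P_eq_gauss[OF L, of "drift_E B (- t)"] t L by auto
  qed
  have poincare: "semigroup_P A B t (\<lambda>y. (f y)\<^sup>2) x - (semigroup_P A B t f x)\<^sup>2 \<le>
           semigroup_P A B t
             (\<lambda>y. (integral {0..t}
                      (\<lambda>s. drift_E B (- (t - s)) ** A ** transpose (drift_E B (- (t - s))))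
                    *v grad f y) \<bullet> grad f y) x"
    if f: "C1_fun f" and lip: "c-lipschitz_on UNIV f" and bd: "bounded (range f)" and t0: "0 \<le> t" for f c t x
  proof (cases "t = 0")
    case True
    then show ?thesis by (simp add: semigroup_P_def)
  next
    case False
    with t0 have t: "0 < t" by simp
    let ?M = "drift_E B (- t)"
    obtain L :: "real^'n^'n" where L: "cov_C A B t = L ** transpose L"
      and P: "\<And>f x. f \<in> borel_measurable borel \<Longrightarrow>
        semigroup_P A B t f x = (\<integral>w. f (?M *v x + (?M ** L) *v w) \<partial>gauss)"
      using rep[OF t] by blast
    have Sigma: "integral {0..t} (\<lambda>s. drift_E B (- (t - s)) ** A ** transpose (drift_E B (- (t - s))))
        = (?M ** L) ** transpose (?M ** L)"
      unfolding cov_C_congruence[OF nil] L by (simp only: matrix_transpose_mul matrix_mul_assoc)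
    have [measurable]: "f \<in> borel_measurable borel"
      using lipschitz_on_continuous_on[OF lip] by (rule borel_measurable_continuous_onI)
    have [measurable]: "grad f \<in> borel_measurable borel"
      using f by (intro borel_measurable_continuous_onI) (simp add: C1_fun_def)
    have [measurable]: "(\<lambda>y. N *v y) \<in> borel_measurable borel" for N :: "real^'n^'n"
      by (intro borel_measurable_continuous_onI continuous_intros)
    obtain b where "\<And>x. \<bar>f x\<bar> \<le> b"
      using bd by (auto simp: bounded_iff)
    from gauss_affine_poincare[OF f lip this, of "?M *v x" "?M ** L"] show ?thesis
      unfolding Sigma by (subst (1 2 3) P) measurable
  qed
  have reverse: "semigroup_P A B t f differentiable (at x) \<and>
           semigroup_P A B t (\<lambda>y. (f y)\<^sup>2) x - (semigroup_P A B t f x)\<^sup>2 \<ge>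
           (cov_C A B t *v grad (semigroup_P A B t f) x) \<bullet> grad (semigroup_P A B t f) x"
    if t: "0 < t" and [measurable]: "f \<in> borel_measurable borel" and bd: "bounded (range f)" for f t x
  proof -
    let ?M = "drift_E B (- t)"
    obtain L :: "real^'n^'n" where L: "cov_C A B t = L ** transpose L" "det L \<noteq> 0"
      and P: "\<And>f x. f \<in> borel_measurable borel \<Longrightarrow>
        semigroup_P A B t f x = (\<integral>w. f (?M *v x + (?M ** L) *v w) \<partial>gauss)"
      using rep[OF t] by blast
    obtain b where b: "\<And>x. \<bar>f x\<bar> \<le> b"
      using bd by (auto simp: bounded_iff)
    have P2: "semigroup_P A B t (\<lambda>y. (f y)\<^sup>2) x = (\<integral>w. (f (?M *v x + (?M ** L) *v w))\<^sup>2 \<partial>gauss)"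
      by (rule P) measurable
    show ?thesis
      using gauss_affine_reverse_poincare[OF that(2) b L(2) P[OF that(2)], of x]
      unfolding P2 L(1) by blast
  qed
  show ?thesis using poincare reverse by blast
qed

end
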